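(* Let $\{R_i\}_{i\in I}$ be a collection of biclosed sets of positive roots for the rank $3$ universal Coxeter group $U_3$. The join of $\{R_i\}_{i\in I}$ in the extended weak order is the smallest closed subset of $\Phi^+$ that contains $\bigcup_{i\in I}R_i$.
   Context: $U_3=\langle s_1,s_2,s_3\mid s_1^2=s_2^2=s_3^2=\mathrm{id}\rangle$. Let $V=\mathbb{R}^3$ with basis $\Delta=\{\alpha_1,\alpha_2,\alpha_3\}$ and symmetric bilinear form $\langle\alpha_i,\alpha_j\rangle=1$ if $i=j$ and $-1$ if $i\neq j$. The group $U_3$ acts linearly on $V$ by $s_i(x)=x-2\langle\alpha_i,x\rangle\alpha_i$. The root system is $\Phi=\{w\cdot\alpha_i: w\in U_3,\ i\in\{1,2,3\}\}$. For $X\subseteq V$, $\mathrm{Span}_{\geq 0}X$ is the set of all nonnegative linear combinations of vectors in $X$, and $\Phi^+=\Phi\cap\mathrm{Span}_{\geq0}(\Delta)$ is the set of positive roots. A set $R\subseteq\Phi^+$ is closed if for all $\alpha,\beta\in R$ we have $\mathrm{Span}_{\geq0}\{\alpha,\beta\}\cap\Phi^+\subseteq R$. It is biclosed if both $R$ and $\Phi^+\setminus R$ are closed. The extended weak order of $U_3$ is the collection of biclosed subsets of $\Phi^+$, partially ordered by containment; joins are least upper bounds in this poset. *)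

theory Defs
  imports "HOL-Analysis.Analysis" "HOL-Algebra.Group"
begin

section \<open>The universal Coxeter group of rank 3\<close>

text \<open>Since every generator is an involution, the group \<open>\<langle>s\<^sub>1, s\<^sub>2, s\<^sub>3 | s\<^sub>i\<^sup>2 = id\<rangle>\<close> is the quotient
  of the free monoid on the three generators by the congruence generated by \<open>s\<^sub>i s\<^sub>i = id\<close>.
  The letters are the elements of the three-element type \<^typ>\<open>3\<close>; the same type
  indexes the coordinates of \<^typ>\<open>real ^ 3\<close>.\<close>

inductive u3_rel :: "3 list \<Rightarrow> 3 list \<Rightarrow> bool" where
  refl: "u3_rel w w"
| sym: "u3_rel v w \<Longrightarrow> u3_rel w v"
| trans: "u3_rel u v \<Longrightarrow> u3_rel v w \<Longrightarrow> u3_rel u w"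
| cancel: "u3_rel (u @ [i, i] @ v) (u @ v)"

lemma equivp_u3_rel: "equivp u3_rel"
  by (rule equivpI) (auto simp: reflp_def symp_def transp_def intro: u3_rel.intros)

lemma u3_rel_append_left: "u3_rel v w \<Longrightarrow> u3_rel (u @ v) (u @ w)"
proof (induction rule: u3_rel.induct)
  case (cancel x i y)
  then show ?case using u3_rel.cancel[of "u @ x" i y] by simp
qed (auto intro: u3_rel.intros)

lemma u3_rel_append_right: "u3_rel v w \<Longrightarrow> u3_rel (v @ u) (w @ u)"
proof (induction rule: u3_rel.induct)
  case (cancel x i y)
  then show ?case using u3_rel.cancel[of x i "y @ u"] by simp
qed (auto intro: u3_rel.intros)

lemma u3_rel_append: "u3_rel v v' \<Longrightarrow> u3_rel w w' \<Longrightarrow> u3_rel (v @ w) (v' @ w')"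
  by (meson u3_rel.trans u3_rel_append_left u3_rel_append_right)

lemma u3_rel_rev_append: "u3_rel (rev w @ w) []"
proof (induction w)
  case (Cons i w)
  have "u3_rel (rev w @ [i, i] @ w) (rev w @ w)"
    by (rule u3_rel.cancel)
  with Cons show ?case
    by (auto intro: u3_rel.trans)
qed (simp add: u3_rel.refl)

quotient_type u3 = "3 list" / u3_rel
  by (rule equivp_u3_rel)

lift_definition u3_mult :: "u3 \<Rightarrow> u3 \<Rightarrow> u3" is "(@)"
  by (rule u3_rel_append)

lift_definition u3_one :: u3 is "[]" .

lift_definition u3_gen :: "3 \<Rightarrow> u3" is "\<lambda>i. [i]" .

definition U3 :: "u3 monoid" where
  "U3 = \<lparr>carrier = UNIV, mult = u3_mult, one = u3_one\<rparr>"

lemma group_U3: "group U3"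
proof (rule groupI)
  fix x y z assume "x \<in> carrier U3"
  show "x \<otimes>\<^bsub>U3\<^esub> y \<otimes>\<^bsub>U3\<^esub> z = x \<otimes>\<^bsub>U3\<^esub> (y \<otimes>\<^bsub>U3\<^esub> z)"
    unfolding U3_def by simp (transfer, simp add: u3_rel.refl)
  show "\<one>\<^bsub>U3\<^esub> \<otimes>\<^bsub>U3\<^esub> x = x"
    unfolding U3_def by simp (transfer, simp add: u3_rel.refl)
  have "\<exists>y. u3_mult y x = u3_one"
    by transfer (blast intro: u3_rel_rev_append)
  then show "\<exists>y\<in>carrier U3. y \<otimes>\<^bsub>U3\<^esub> x = \<one>\<^bsub>U3\<^esub>"
    by (simp add: U3_def)
qed (simp_all add: U3_def)

lemma u3_gen_involution: "u3_gen i \<otimes>\<^bsub>U3\<^esub> u3_gen i = \<one>\<^bsub>U3\<^esub>"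
  unfolding U3_def
  by simp (transfer, use u3_rel.cancel[of "[]" _ "[]"] in simp)

text \<open>The universal property of the presentation.\<close>

lemma U3_universal:
  fixes t :: "3 \<Rightarrow> 'g" and G :: "('g, 'm) monoid_scheme"
  assumes "group G" and t: "\<And>i. t i \<in> carrier G" "\<And>i. t i \<otimes>\<^bsub>G\<^esub> t i = \<one>\<^bsub>G\<^esub>"
  shows "\<exists>h\<in>hom U3 G. \<forall>i. h (u3_gen i) = t i"
proof -
  interpret group G by fact
  define f where "f w = foldr (\<lambda>i x. t i \<otimes>\<^bsub>G\<^esub> x) w \<one>\<^bsub>G\<^esub>" for w
  have f_simps [simp]: "f [] = \<one>\<^bsub>G\<^esub>" "f (i # w) = t i \<otimes>\<^bsub>G\<^esub> f w" for i w
    by (simp_all add: f_def)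
  have f_closed [simp]: "f w \<in> carrier G" for w
    by (induction w) (auto simp: t)
  have f_append: "f (v @ w) = f v \<otimes>\<^bsub>G\<^esub> f w" for v w
    by (induction v) (auto simp: t m_assoc)
  have f_rel: "f v = f w" if "u3_rel v w" for v w
    using that
  proof (induction rule: u3_rel.induct)
    case (cancel u i v)
    have "t i \<otimes>\<^bsub>G\<^esub> (t i \<otimes>\<^bsub>G\<^esub> f v) = f v"
      by (simp add: t flip: m_assoc)
    then show ?case by (simp add: f_append)
  qed auto
  define h where "h x = f (rep_u3 x)" for x
  have h_abs: "h (abs_u3 w) = f w" for w
    unfolding h_def by (rule f_rel) (simp add: Quotient3_rep_abs[OF Quotient3_u3] u3_rel.refl)
  have abs: "\<exists>w. x = abs_u3 w" for x
    by (metis Quotient3_abs_rep[OF Quotient3_u3])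
  have "h (u3_mult x y) = h x \<otimes>\<^bsub>G\<^esub> h y" for x y
    using abs[of x] abs[of y] by (auto simp: u3_mult.abs_eq h_abs f_append)
  then have "h \<in> hom U3 G"
    by (auto simp: hom_def U3_def h_def)
  moreover have "h (u3_gen i) = t i" for i
    by (simp add: u3_gen_def h_abs t)
  ultimately show ?thesis by blast
qed

section \<open>The reflection representation\<close>

abbreviation simple_root :: "3 \<Rightarrow> real ^ 3" where
  "simple_root i \<equiv> axis i 1"

definition form :: "real ^ 3 \<Rightarrow> real ^ 3 \<Rightarrow> real" where
  "form x y = (\<Sum>i\<in>UNIV. \<Sum>j\<in>UNIV. x $ i * y $ j * (if i = j then 1 else - 1))"

lemma form_simple_root: "form (simple_root i) (simple_root j) = (if i = j then 1 else - 1)"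
  using exhaust_3[of i] exhaust_3[of j] by (auto simp: form_def sum_3 axis_def)

lemma bilinear_form: "bilinear form"
  unfolding bilinear_def form_def sum_3
  by (auto intro!: linearI simp: algebra_simps)

lemma form_commute: "form x y = form y x"
  unfolding form_def by (subst sum.swap) (simp add: mult_ac eq_commute)

definition reflect :: "3 \<Rightarrow> real ^ 3 \<Rightarrow> real ^ 3" where
  "reflect i x = x - (2 * form (simple_root i) x) *\<^sub>R simple_root i"

lemma linear_reflect: "linear (reflect i)"
  using bilinear_form unfolding bilinear_def reflect_def
  by (auto intro!: linearI simp: linear_add linear_cmul algebra_simps)

lemma reflect_reflect: "reflect i (reflect i x) = x"
proof -
  have "form (simple_root i) (reflect i x) = - form (simple_root i) x"
    by (simp add: reflect_def bilinear_rsub[OF bilinear_form] bilinear_rmul[OF bilinear_form]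
        form_simple_root)
  then show ?thesis by (simp add: reflect_def[of i "reflect i x"]) (simp add: reflect_def)
qed

lift_definition u3_act :: "u3 \<Rightarrow> real ^ 3 \<Rightarrow> real ^ 3" is "foldr reflect"
  subgoal premises prems for v w
    using prems by (induction rule: u3_rel.induct) (auto simp: reflect_reflect fun_eq_iff)
  done

lemma u3_act_gen: "u3_act (u3_gen i) x = reflect i x"
  by transfer simp

lemma u3_act_one: "u3_act \<one>\<^bsub>U3\<^esub> x = x"
  unfolding U3_def by simp (transfer, simp)

lemma u3_act_mult: "u3_act (v \<otimes>\<^bsub>U3\<^esub> w) x = u3_act v (u3_act w x)"
  unfolding U3_def by simp (transfer, simp)

section \<open>Roots and the extended weak order\<close>

definition roots :: "(real ^ 3) set" where
  "roots = {u3_act w (simple_root i) | w i. w \<in> carrier U3}"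

definition nonneg_span :: "(real ^ 3) set \<Rightarrow> (real ^ 3) set" where
  "nonneg_span X =
    {\<Sum>x\<in>F. c x *\<^sub>R x | F c. finite F \<and> F \<subseteq> X \<and> (\<forall>x\<in>F. 0 \<le> c x)}"

definition positive_roots :: "(real ^ 3) set" where
  "positive_roots = roots \<inter> nonneg_span (range simple_root)"

definition root_closed :: "(real ^ 3) set \<Rightarrow> bool" where
  "root_closed R \<longleftrightarrow> R \<subseteq> positive_roots \<and>
    (\<forall>\<alpha>\<in>R. \<forall>\<beta>\<in>R. nonneg_span {\<alpha>, \<beta>} \<inter> positive_roots \<subseteq> R)"

definition root_biclosed :: "(real ^ 3) set \<Rightarrow> bool" where
  "root_biclosed R \<longleftrightarrow> root_closed R \<and> root_closed (positive_roots - R)"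

definition extended_weak_order :: "(real ^ 3) set gorder" where
  "extended_weak_order = \<lparr>carrier = {R. root_biclosed R}, eq = (=), le = (\<subseteq>)\<rparr>"

lemma partial_order_extended_weak_order: "partial_order extended_weak_order"
  by unfold_locales (auto simp: extended_weak_order_def)

text \<open>The set \<open>root_closed hull X\<close> is by definition the intersection of all closed sets containing
  \<open>X\<close>. For every set \<open>X\<close> of positive roots it is itself closed, hence it is the smallest closed set
  containing \<open>X\<close>.\<close>

lemma root_closed_hull_smallest:
  assumes "X \<subseteq> positive_roots"
  shows "root_closed (root_closed hull X)" "X \<subseteq> root_closed hull X"
    "\<And>C. root_closed C \<Longrightarrow> X \<subseteq> C \<Longrightarrow> root_closed hull X \<subseteq> C"
proof -
  have "root_closed positive_roots"
    by (simp add: root_closed_def)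
  with assms show "root_closed (root_closed hull X)"
    unfolding root_closed_def hull_def by blast
qed (simp_all add: hull_subset hull_minimal)

end

theory Submission
  imports Defs "HOL-Library.Sublist"
begin

text \<open>
  The union \<open>X\<close> of the given biclosed sets is coclosed: its complement in the positive roots is
  closed. The theorem follows once the closure \<open>C\<close> of any coclosed set \<open>X\<close> is known to be coclosed again (\<open>root_closed_hull_coclosed\<close>): then \<open>C\<close> is biclosed, and every biclosed
  upper bound is closed, so it contains \<open>C\<close>.

  The form has signature \<open>(2, 1)\<close>, so the roots are the oriented lines of a tessellation of the
  hyperbolic plane by ideal triangles, and the positive roots are the edges of the dual trivalent
  tree, rooted at the identity. Combinatorially, a positive root is a nonempty reduced word. Words
  comparable in the prefix order give nested half-planes and form values at least \<open>1\<close>, parallel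
  (incomparable) words give disjoint half-planes and form values at most \<open>- 1\<close>. The lines through one
  ideal vertex form a fan; its roots lie in a plane, ordered by their direction.

  Let \<open>N\<close> be the complement of \<open>C\<close>. The goal is a linear functional \<open>n \<noteq> 0\<close> that is nonpositive on
  \<open>X\<close> and nonnegative on \<open>N\<close>. Given such an \<open>n\<close>, it is nonpositive on \<open>C\<close>, hence a root of \<open>C\<close> between
  two roots of \<open>N\<close> could only lie in the plane \<open>n = 0\<close>, together with these two; inside a plane the
  roots are linearly ordered by direction, and coclosedness of \<open>X\<close> gives a contradiction
  (\<open>complement_closed\<close>).

  The functional comes from two ingredients.

  First, \<open>X\<close> and \<open>N\<close> do not interleave on the circle at infinity (\<open>no_alternation\<close>). Descending
  the tree along the boundary between them, at each vertex either one of the two branches lies in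
  \<open>C\<close> or the other one misses \<open>X\<close> (\<open>branch_dichotomy\<close>); the proof looks only at the three fans at that vertex.

  Second, this planar statement about pairwise disjoint half-planes controls nested ones too, since a
  root whose word \<open>v\<close> properly extends \<open>u\<close> is a positive combination of the root of \<open>u\<close> and the root
  of a word that is parallel to \<open>u\<close> and shorter than \<open>v\<close> (\<open>strict_prefix_root_decomposition\<close>). Take a simple root
  \<open>\<alpha>\<^sub>k\<close> such that all words starting with \<open>k\<close> are in \<open>C\<close>, or none of them is in \<open>X\<close>
  (\<open>ex_pure_letter\<close>). If no separating functional existed, Caratheodory's theorem would produce, up
  to exchanging \<open>X\<close> and \<open>N\<close>, one of two small configurations: a segment from a root of one set to
  \<open>\<alpha>\<^sub>k\<close> crossing a segment between two roots of the other set, or a root of one set in a triangle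
  spanned by \<open>\<alpha>\<^sub>k\<close> and two roots of the other set. A descent on word lengths reduces both to a
  forbidden interleaving (\<open>no_crossing\<close>, \<open>no_inside\<close>).
\<close>

section \<open>Reduced words and positive roots\<close>

abbreviation reduced_word :: "3 list \<Rightarrow> bool" where
  "reduced_word w \<equiv> w \<noteq> [] \<and> distinct_adj w"

abbreviation act :: "3 list \<Rightarrow> real ^ 3 \<Rightarrow> real ^ 3" where
  "act \<equiv> foldr reflect"

text \<open>The word \<open>w @ [l]\<close> names the root \<open>w \<alpha>\<^sub>l\<close>, whose reflection exchanges the two ends of the tree
  edge from \<open>w\<close> to \<open>w @ [l]\<close>.\<close>

primrec root_of :: "3 list \<Rightarrow> real ^ 3" where
  "root_of [] = 0"
| "root_of (a # w) = (if w = [] then simple_root a else reflect a (root_of w))"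

lemma form_simple_left: "form (simple_root a) x = 2 * x $ a - (x $ 1 + x $ 2 + x $ 3)"
  using exhaust_3[of a] by (auto simp: form_def sum_3 axis_def)

lemma form_add_left: "form (x + y) z = form x z + form y z"
  and form_add_right: "form z (x + y) = form z x + form z y"
  and form_scale_left: "form (c *\<^sub>R x) z = c * form x z"
  and form_scale_right: "form z (c *\<^sub>R x) = c * form z x"
  and form_diff_left: "form (x - y) z = form x z - form y z"
  and form_diff_right: "form z (x - y) = form z x - form z y"
  and form_minus_left: "form (- x) z = - form x z"
  and form_minus_right: "form z (- x) = - form z x"
  and form_zero_left: "form 0 z = 0"
  and form_zero_right: "form z 0 = 0"
  by (simp_all add: form_def sum_3 algebra_simps)

lemmas form_simps = form_add_left form_add_right form_scale_left form_scale_right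
  form_diff_left form_diff_right form_minus_left form_minus_right form_zero_left form_zero_right

lemma reflect_simple_root: "reflect a (simple_root a) = - simple_root a"
  by (simp add: reflect_def form_simple_root scaleR_2)

lemma form_reflect: "form (reflect a x) (reflect a y) = form x y"
  by (simp add: reflect_def form_simps form_simple_root form_commute[of x] algebra_simps)

lemma form_reflect_left: "form (reflect a x) y = form x (reflect a y)"
  by (metis form_reflect reflect_reflect)

lemma form_act: "form (act w x) (act w y) = form x y"
  by (induction w) (auto simp: form_reflect)

lemma linear_act: "linear (act w)"
proof (induction w)
  case (Cons a w)
  then show ?case
    using linear_compose[OF Cons linear_reflect[of a]] by (simp add: comp_def)
qed (simp add: linear_iff)

lemma act_rev_act: "act (rev w) (act w x) = x"
  by (induction w arbitrary: x) (auto simp: reflect_reflect)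

lemma act_act_rev: "act w (act (rev w) x) = x"
  using act_rev_act[of "rev w"] by simp

lemma root_append: "v \<noteq> [] \<Longrightarrow> root_of (u @ v) = act u (root_of v)"
  by (induction u) auto

lemma form_root_append:
  "u \<noteq> [] \<Longrightarrow> v \<noteq> [] \<Longrightarrow> form (root_of (g @ u)) (root_of (g @ v)) = form (root_of u) (root_of v)"
  by (simp add: root_append form_act)

text \<open>The form of \<open>\<alpha>\<^sub>b\<close> with \<open>x\<close> is the \<open>b\<close>-coordinate of \<open>x\<close> minus the two others. Reflecting in a new
  letter \<open>a\<close> changes the \<open>a\<close>-coordinate only, and makes it exceed the sum of the others.\<close>

lemma root_coords_and_form:
  assumes "reduced_word w"
  shows "(\<forall>i. 0 \<le> root_of w $ i) \<and>
    (\<forall>b. if b = hd w then 1 \<le> form (simple_root b) (root_of w) else form (simple_root b) (root_of w) \<le> - 1)"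
  using assms
proof (induction w)
  case (Cons a w)
  show ?case
  proof (cases "w = []")
    case True
    have "0 \<le> simple_root a $ i" for i by (simp add: axis_def)
    then show ?thesis using True by (simp add: form_simple_root)
  next
    case False
    with Cons have aw: "a \<noteq> hd w" and dw: "distinct_adj w" by (auto simp: distinct_adj_Cons)
    let ?r = "root_of w"
    from Cons.IH dw False have nn: "\<And>i. 0 \<le> ?r $ i"
      and fb: "\<And>b. if b = hd w then 1 \<le> form (simple_root b) ?r else form (simple_root b) ?r \<le> - 1"
      by blast+
    define F where "F = form (simple_root a) ?r"
    have F: "F \<le> - 1" using fb[of a] aw by (auto simp: F_def)
    have root: "root_of (a # w) = ?r - (2 * F) *\<^sub>R simple_root a"
      using False by (simp add: reflect_def F_def)
    have "0 \<le> root_of (a # w) $ i" for i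
      using nn[of i] F by (auto simp: root axis_def simp del: root_of.simps)
    moreover have "if b = a then 1 \<le> form (simple_root b) (root_of (a # w))
        else form (simple_root b) (root_of (a # w)) \<le> - 1" for b
    proof (cases "b = a")
      case True
      then show ?thesis using F by (simp add: root form_simps form_simple_root F_def[symmetric] del: root_of.simps)
    next
      case ba: False
      have "form (simple_root b) (root_of (a # w)) = form (simple_root b) ?r + 2 * F"
        using ba by (simp add: root form_simps form_simple_root del: root_of.simps)
      also have "\<dots> \<le> - 1"
        using F nn[of 1] nn[of 2] nn[of 3] ba exhaust_3[of a] exhaust_3[of b]
        unfolding F_def form_simple_left by auto
      finally show ?thesis using ba by simp
    qed
    ultimately show ?thesis by (simp del: root_of.simps)
  qed
qed simp

lemma root_nonneg: "reduced_word w \<Longrightarrow> 0 \<le> root_of w $ i"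
  using root_coords_and_form by blast

lemma form_simple_root_hd: "reduced_word w \<Longrightarrow> 1 \<le> form (simple_root (hd w)) (root_of w)"
  using root_coords_and_form[of w] by presburger

lemma form_simple_root_not_hd:
  "reduced_word w \<Longrightarrow> b \<noteq> hd w \<Longrightarrow> form (simple_root b) (root_of w) \<le> - 1"
  using root_coords_and_form[of w] by presburger

lemma form_root_self: "w \<noteq> [] \<Longrightarrow> form (root_of w) (root_of w) = 1"
  by (induction w) (auto simp: form_simple_root form_reflect)

lemma root_nonzero: "w \<noteq> [] \<Longrightarrow> root_of w \<noteq> 0"
  using form_root_self[of w] by (auto simp: form_simps)

text \<open>Reflections can be moved from one argument of the form to the other. Moving all but the last letter
  of \<open>u\<close> in front of \<open>v\<close> keeps that word reduced, and leaves the form of a simple root with a root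
  starting with a different letter.\<close>

lemma form_root_different_hd:
  "reduced_word u \<Longrightarrow> reduced_word v \<Longrightarrow> hd u \<noteq> hd v \<Longrightarrow> form (root_of u) (root_of v) \<le> - 1"
proof (induction u arbitrary: v)
  case (Cons a u)
  show ?case
  proof (cases "u = []")
    case True
    then show ?thesis using form_simple_root_not_hd[of v a] Cons.prems by simp
  next
    case False
    have v: "root_of (a # v) = reflect a (root_of v)" using Cons.prems by simp
    have "form (root_of (a # u)) (root_of v) = form (root_of u) (root_of (a # v))"
      using False v by (simp add: form_reflect_left)
    also have "\<dots> \<le> - 1"
      using Cons.prems False by (intro Cons.IH) (auto simp: distinct_adj_Cons)
    finally show ?thesis .
  qed
qed simp

lemma form_root_parallel:
  assumes "reduced_word u" "reduced_word v" "u \<parallel> v"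
  shows "form (root_of u) (root_of v) \<le> - 1"
proof -
  obtain g a u' b v' where ab: "a \<noteq> b" and u: "u = g @ a # u'" and v: "v = g @ b # v'"
    using parallel_decomp[OF assms(3)] by blast
  have "form (root_of u) (root_of v) = form (root_of (a # u')) (root_of (b # v'))"
    unfolding u v by (rule form_root_append) simp_all
  also have "\<dots> \<le> - 1"
    using assms(1,2) ab unfolding u v
    by (intro form_root_different_hd) (auto simp: distinct_adj_append_iff)
  finally show ?thesis .
qed

lemma form_root_prefix:
  assumes "reduced_word u" "reduced_word v" "prefix u v"
  shows "1 \<le> form (root_of u) (root_of v)"
proof -
  obtain g m where u: "u = g @ [m]" using assms(1) by (metis rev_exhaust)
  obtain z where v: "v = g @ m # z" using assms(3) u by (auto simp: prefix_def)
  have "form (root_of u) (root_of v) = form (root_of [m]) (root_of (m # z))"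
    unfolding u v by (rule form_root_append) simp_all
  also have "1 \<le> \<dots>"
    using form_simple_root_hd[of "m # z"] assms(2) unfolding v by (auto simp: distinct_adj_append_iff)
  finally show ?thesis .
qed

lemma form_root_pos_imp_comparable:
  assumes "reduced_word u" "reduced_word v" "0 < form (root_of u) (root_of v)"
  shows "prefix u v \<or> strict_prefix v u"
proof (rule ccontr)
  assume "\<not> ?thesis"
  then have "u \<parallel> v" by (auto simp: parallel_def strict_prefix_def)
  then show False using form_root_parallel[OF assms(1,2)] assms(3) by simp
qed

lemma root_inject:
  assumes "reduced_word u" "reduced_word v" "root_of u = root_of v"
  shows "u = v"
proof -
  have *: False if hyp: "reduced_word u" "reduced_word v" "root_of u = root_of v" "strict_prefix u v" for u v
  proof -
    obtain g m where u: "u = g @ [m]" using hyp(1) by (metis rev_exhaust)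
    obtain z where v: "v = g @ m # z" and z: "z \<noteq> []"
      using hyp(4) u by (auto simp: strict_prefix_def prefix_def)
    have "act g (root_of [m]) = act g (root_of (m # z))"
      using hyp(3) unfolding u v by (simp add: root_append del: root_of.simps)
    then have "act (rev g) (act g (root_of [m])) = act (rev g) (act g (root_of (m # z)))"
      by (simp only:)
    then have "root_of [m] = root_of (m # z)"
      by (simp only: act_rev_act)
    then have sm: "simple_root m = reflect m (root_of z)"
      using z by simp
    have "root_of z = reflect m (reflect m (root_of z))"
      by (simp only: reflect_reflect)
    also have "\<dots> = - simple_root m"
      by (simp only: sm[symmetric] reflect_simple_root)
    finally have "root_of z $ m = - 1" by simp
    moreover have "0 \<le> root_of z $ m"
      using hyp(2) z unfolding v by (intro root_nonneg) (auto simp: distinct_adj_append_iff distinct_adj_Cons)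
    ultimately show False by simp
  qed
  have "0 < form (root_of u) (root_of v)"
    using form_root_self[of v] assms by simp
  then have "prefix u v \<or> strict_prefix v u"
    using form_root_pos_imp_comparable[OF assms(1,2)] by simp
  then show ?thesis
    using *[of u v] *[of v u] assms by (auto simp: strict_prefix_def)
qed

lemma nonneg_comb_sum:
  assumes "finite F" "F \<subseteq> X" "\<forall>x\<in>F. 0 \<le> c x"
  shows "(\<Sum>x\<in>F. c x *\<^sub>R x) \<in> nonneg_span X"
  unfolding nonneg_span_def using assms by blast

lemma nonneg_span_pair:
  "x \<in> nonneg_span {u, v} \<longleftrightarrow> (\<exists>a b. 0 \<le> a \<and> 0 \<le> b \<and> x = a *\<^sub>R u + b *\<^sub>R v)"
proof
  assume "x \<in> nonneg_span {u, v}"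
  then obtain F c where F: "finite F" "F \<subseteq> {u, v}" "\<forall>y\<in>F. 0 \<le> c y" and x: "x = (\<Sum>y\<in>F. c y *\<^sub>R y)"
    unfolding nonneg_span_def by blast
  define d where "d y = (if y \<in> F then c y else 0)" for y
  have d: "0 \<le> d y" for y using F by (simp add: d_def)
  have xd: "x = (\<Sum>y\<in>{u, v}. d y *\<^sub>R y)"
    unfolding x using F by (intro sum.mono_neutral_cong_left) (auto simp: d_def)
  show "\<exists>a b. 0 \<le> a \<and> 0 \<le> b \<and> x = a *\<^sub>R u + b *\<^sub>R v"
  proof (cases "u = v")
    case True
    then show ?thesis using xd d[of u] by (intro exI[of _ "d u"] exI[of _ 0]) simp
  next
    case False
    then show ?thesis using xd d by (intro exI[of _ "d u"] exI[of _ "d v"]) simp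
  qed
next
  assume "\<exists>a b. 0 \<le> a \<and> 0 \<le> b \<and> x = a *\<^sub>R u + b *\<^sub>R v"
  then obtain a b where ab: "0 \<le> a" "0 \<le> b" and x: "x = a *\<^sub>R u + b *\<^sub>R v" by blast
  define c where "c y = (if u = v then a + b else if y = u then a else b)" for y
  have "x = (\<Sum>y\<in>{u, v}. c y *\<^sub>R y)"
    unfolding x by (cases "u = v") (auto simp: c_def scaleR_add_left)
  then show "x \<in> nonneg_span {u, v}"
    using ab by (auto simp: c_def intro!: nonneg_comb_sum)
qed

lemma nonneg_span_simple_iff: "x \<in> nonneg_span (range simple_root) \<longleftrightarrow> (\<forall>i. 0 \<le> x $ i)"
proof
  assume "x \<in> nonneg_span (range simple_root)"
  then obtain F c where F: "F \<subseteq> range simple_root" "\<forall>y\<in>F. 0 \<le> c y" and x: "x = (\<Sum>y\<in>F. c y *\<^sub>R y)"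
    unfolding nonneg_span_def by blast
  have "0 \<le> c y * y $ i" if "y \<in> F" for y i
    using that F by (auto simp: axis_def)
  then show "\<forall>i. 0 \<le> x $ i"
    by (auto simp: x sum_nonneg)
next
  assume nn: "\<forall>i. 0 \<le> x $ i"
  have "x = (\<Sum>i\<in>UNIV. x $ i *\<^sub>R simple_root i)"
    by (simp add: vec_eq_iff axis_def if_distrib cong: if_cong)
  also have "\<dots> = (\<Sum>y\<in>range simple_root. (x \<bullet> y) *\<^sub>R y)"
    by (subst sum.reindex) (auto simp: inj_on_def axis_eq_axis inner_axis)
  also have "\<dots> \<in> nonneg_span (range simple_root)"
    using nn by (intro nonneg_comb_sum) (auto simp: inner_axis)
  finally show "x \<in> nonneg_span (range simple_root)" .
qed

text \<open>Reflecting in \<open>a\<close> prepends the letter \<open>a\<close>, or deletes it when the word starts with it; only the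
  one-letter word \<open>[a]\<close> changes the sign.\<close>

lemma act_simple_root_pm:
  "\<exists>w. reduced_word w \<and> (act v (simple_root i) = root_of w \<or> act v (simple_root i) = - root_of w)"
proof (induction v)
  case Nil
  show ?case by (intro exI[of _ "[i]"]) simp
next
  case (Cons a v)
  then obtain w where w: "reduced_word w" "act v (simple_root i) = root_of w \<or> act v (simple_root i) = - root_of w"
    by blast
  have neg: "reflect a (- x) = - reflect a x" for x
    by (simp add: linear_neg[OF linear_reflect])
  have "\<exists>w'. reduced_word w' \<and> (reflect a (root_of w) = root_of w' \<or> reflect a (root_of w) = - root_of w')"
  proof (cases "hd w = a")
    case False
    then show ?thesis using w by (intro exI[of _ "a # w"]) (auto simp: distinct_adj_Cons)
  next
    case True
    then obtain w1 where w1: "w = a # w1" using w by (cases w) auto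
    show ?thesis
    proof (cases "w1 = []")
      case True
      then show ?thesis
        by (intro exI[of _ "[a]"]) (simp add: w1 reflect_simple_root)
    next
      case False
      then show ?thesis using w(1)
        by (intro exI[of _ w1]) (auto simp: w1 reflect_reflect distinct_adj_Cons)
    qed
  qed
  then show ?case using w(2) by (auto simp: neg)
qed

lemma positive_roots_eq: "positive_roots = root_of ` {w. reduced_word w}"
proof (intro equalityI subsetI)
  fix x assume "x \<in> positive_roots"
  then have xr: "x \<in> roots" and nn: "\<And>i. 0 \<le> x $ i"
    by (auto simp: positive_roots_def nonneg_span_simple_iff)
  obtain g i where "x = u3_act g (simple_root i)" using xr by (auto simp: roots_def)
  moreover obtain v where "g = abs_u3 v"
    by (metis Quotient3_abs_rep[OF Quotient3_u3])
  ultimately have "x = act v (simple_root i)"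
    by (simp add: u3_act.abs_eq)
  then obtain w where w: "reduced_word w" "x = root_of w \<or> x = - root_of w"
    using act_simple_root_pm[of v i] by auto
  have "x \<noteq> - root_of w"
  proof
    assume "x = - root_of w"
    then have "root_of w = 0" using nn root_nonneg[OF w(1)] by (auto simp: vec_eq_iff intro!: antisym)
    then show False using root_nonzero w(1) by blast
  qed
  then show "x \<in> root_of ` {w. reduced_word w}" using w by blast
next
  fix x assume "x \<in> root_of ` {w. reduced_word w}"
  then obtain w where w: "reduced_word w" "x = root_of w" by blast
  have "root_of w = act (butlast w) (simple_root (last w))"
    using root_append[of "[last w]" "butlast w"] w(1) by simp
  also have "\<dots> = u3_act (abs_u3 (butlast w)) (simple_root (last w))"
    by (simp add: u3_act.abs_eq)
  finally have "x \<in> roots" using w by (auto simp: roots_def U3_def)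
  then show "x \<in> positive_roots"
    using root_nonneg[OF w(1)] w(2) by (auto simp: positive_roots_def nonneg_span_simple_iff)
qed

lemma nonneg_root_comb_imp_pos:
  assumes "reduced_word u" "reduced_word v" "reduced_word w" "root_of w = a *\<^sub>R root_of u + b *\<^sub>R root_of v"
  shows "0 < a \<or> 0 < b"
proof (rule ccontr)
  assume "\<not> ?thesis"
  then have "root_of w $ i \<le> 0" for i
    using root_nonneg[OF assms(1), of i] root_nonneg[OF assms(2), of i] unfolding assms(4)
    by (simp add: add_nonpos_nonpos mult_nonpos_nonneg)
  then have "root_of w = 0" using root_nonneg[OF assms(3)] by (auto simp: vec_eq_iff intro!: antisym)
  then show False using root_nonzero assms(3) by blast
qed

lemma cancel_words:
  assumes "distinct_adj g" "distinct_adj z"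
  shows "\<exists>g1 y z1. g = g1 @ rev y \<and> z = y @ z1 \<and> (g1 = [] \<or> z1 = [] \<or> last g1 \<noteq> hd z1)"
  using assms
proof (induction z arbitrary: g)
  case (Cons a z)
  show ?case
  proof (cases "g \<noteq> [] \<and> last g = a")
    case True
    then have g: "g = butlast g @ [a]" by (metis append_butlast_last_id)
    have "distinct_adj (butlast g)" using Cons.prems(1) g by (metis distinct_adj_appendD1)
    then obtain g1 y z1 where "butlast g = g1 @ rev y" "z = y @ z1"
      "g1 = [] \<or> z1 = [] \<or> last g1 \<noteq> hd z1"
      using Cons by (meson distinct_adj_ConsD)
    then show ?thesis using g by (intro exI[of _ g1] exI[of _ "a # y"] exI[of _ z1]) auto
  next
    case False
    then show ?thesis by (intro exI[of _ g] exI[of _ "[]"] exI[of _ "a # z"]) auto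
  qed
qed auto

text \<open>The two nested roots lie in a rank two subsystem, and \<open>e\<close> is a root at its opposite end. It is found
  by repeated reflection: reflecting the root of \<open>v\<close> in the root of \<open>u\<close> gives either a positive root,
  which is \<open>e\<close>, or the negative of the root of a proper prefix \<open>s\<close> of \<open>u\<close>. In the second case the
  three roots of \<open>s\<close>, \<open>u\<close>, \<open>v\<close> follow each other in the plane, and the pair \<open>s\<close>, \<open>u\<close> is shorter. The
  bound on the length of \<open>e\<close> drives all later descents.\<close>

lemma strict_prefix_root_decomposition:
  assumes "reduced_word u" "reduced_word v" "strict_prefix u v"
  shows "\<exists>e s t. reduced_word e \<and> e \<parallel> u \<and> 0 < s \<and> 0 < t \<and>
    root_of v = s *\<^sub>R root_of u + t *\<^sub>R root_of e \<and> length e < length v"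
  using assms
proof (induction "length v" arbitrary: u v rule: less_induct)
  case less
  obtain g m where u: "u = g @ [m]" using less.prems(1) by (metis rev_exhaust)
  obtain z where v: "v = g @ m # z" and z: "z \<noteq> []"
    using less.prems(3) u by (auto simp: strict_prefix_def prefix_def)
  have rz: "reduced_word z" "hd z \<noteq> m" and gm: "g = [] \<or> last g \<noteq> m" and dg: "distinct_adj g"
    using less.prems(2) z unfolding v by (auto simp: distinct_adj_append_iff distinct_adj_Cons)
  \<comment> \<open>In the frame at \<open>g\<close> the root of \<open>u\<close> is \<open>\<alpha>\<^sub>m\<close> and reflecting in it amounts to deleting the letter \<open>m\<close>.\<close>
  define c where "c = - form (simple_root m) (root_of z)"
  have c: "1 \<le> c" using form_simple_root_not_hd[OF rz(1), of m] rz(2) by (auto simp: c_def)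
  have "root_of v = act g (reflect m (root_of z))"
    using z by (simp add: v root_append)
  also have "reflect m (root_of z) = root_of z + (2 * c) *\<^sub>R simple_root m"
    by (simp add: reflect_def c_def)
  also have "act g \<dots> = act g (root_of z) + (2 * c) *\<^sub>R root_of u"
    by (simp add: linear_add[OF linear_act] linear_cmul[OF linear_act] u root_append)
  finally have rv: "root_of v = act g (root_of z) + (2 * c) *\<^sub>R root_of u" .
  \<comment> \<open>The sign of the reflected root is read off after cancelling \<open>g\<close> against \<open>z\<close>.\<close>
  obtain g1 y z1 where g: "g = g1 @ rev y" and zz: "z = y @ z1"
    and red: "g1 = [] \<or> z1 = [] \<or> last g1 \<noteq> hd z1"
    using cancel_words[OF dg] rz by blast
  show ?case
  proof (cases "z1 = []")
    case False
    define e where "e = g1 @ z1"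
    have "act g (root_of z) = root_of e"
      using False by (simp add: g zz e_def root_append act_rev_act)
    moreover have "reduced_word e"
      using False red dg rz unfolding e_def g zz by (auto simp: distinct_adj_append_iff)
    moreover have "e \<parallel> u"
    proof -
      have "\<exists>h r. rev y @ [m] = h # r \<and> h \<noteq> hd z1"
      proof (cases "y = []")
        case True
        then show ?thesis using rz(2) zz by auto
      next
        case yne: False
        then have "rev y @ [m] = last y # tl (rev y) @ [m]"
          by (metis append_Cons hd_Cons_tl hd_rev rev_is_Nil_conv)
        moreover have "last y \<noteq> hd z1"
          using rz(1) False yne unfolding zz by (auto simp: distinct_adj_append_iff)
        ultimately show ?thesis by blast
      qed
      then obtain h r where h: "rev y @ [m] = h # r" "h \<noteq> hd z1" by blast
      then have "u = g1 @ h # r" by (simp add: u g)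
      moreover have "e = g1 @ hd z1 # tl z1" using False by (simp add: e_def)
      ultimately show ?thesis using h(2) by (auto simp: parallel_def)
    qed
    moreover have "length e < length v" by (simp add: e_def v g zz)
    ultimately show ?thesis using c rv
      by (intro exI[of _ e] exI[of _ "2 * c"] exI[of _ 1]) auto
  next
    case True
    then have "z = y" using zz by simp
    then obtain z' l where zl: "z = z' @ [l]" using z by (metis rev_exhaust)
    define s where "s = g1 @ [l]"
    have gl: "g = s @ rev z'" by (simp add: g s_def \<open>z = y\<close>[symmetric] zl)
    have "act g (root_of z) = act g1 (reflect l (simple_root l))"
      by (simp add: gl s_def zl root_append act_rev_act)
    also have "reflect l (simple_root l) = - simple_root l"
      by (rule reflect_simple_root)
    also have "act g1 \<dots> = - root_of s"
      by (simp add: linear_neg[OF linear_act] s_def root_append)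
    finally have rv': "root_of v = (2 * c) *\<^sub>R root_of u - root_of s" using rv by simp
    have rs: "reduced_word s" using dg unfolding gl s_def by (auto simp: distinct_adj_append_iff)
    have su: "strict_prefix s u" unfolding u gl by (auto simp: strict_prefix_def)
    have "length u < length v" using less.prems(3) by (simp add: prefix_length_less)
    from less.hyps[OF this rs less.prems(1) su]
    obtain e A B where e: "reduced_word e" "e \<parallel> s" "0 < A" "0 < B"
      and ru: "root_of u = A *\<^sub>R root_of s + B *\<^sub>R root_of e" and le: "length e < length u" by blast
    have "form (root_of s) (root_of u) = A + B * form (root_of s) (root_of e)"
      using form_root_self[of s] rs by (simp add: ru form_simps)
    moreover have "form (root_of s) (root_of e) \<le> - 1"
      using form_root_parallel[of s e] rs e by (auto simp: parallel_commute)
    moreover have "1 \<le> form (root_of s) (root_of u)"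
      using form_root_prefix[of s u] rs less.prems(1) su by (simp add: strict_prefix_def)
    \<comment> \<open>The bound \<open>A \<ge> 1\<close> keeps the coefficient \<open>2 c - 1 / A\<close> positive.\<close>
    ultimately have A: "1 \<le> A"
      using e(4) by (smt (verit, ccfv_SIG) mult_le_0_iff)
    have "root_of s = (1 / A) *\<^sub>R root_of u - (B / A) *\<^sub>R root_of e"
      using e(3) by (simp add: ru algebra_simps)
    then have "root_of v = (2 * c - 1 / A) *\<^sub>R root_of u + (B / A) *\<^sub>R root_of e"
      by (simp add: rv' algebra_simps)
    moreover have "0 < 2 * c - 1 / A"
      using A c by (smt (verit) divide_le_eq_1_pos)
    moreover have "e \<parallel> u"
      using e(2) su by (meson parallelE parallelI prefix_order.trans prefix_same_cases strict_prefix_def)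
    ultimately show ?thesis using e le \<open>length u < length v\<close>
      by (intro exI[of _ e] exI[of _ "2 * c - 1 / A"] exI[of _ "B / A"]) auto
  qed
qed

section \<open>The planar order of roots\<close>

text \<open>The determinant with rows \<open>x\<close>, \<open>y\<close>, \<open>z\<close>. For \<open>z = \<alpha>\<^sub>k\<close> its sign compares the directions of \<open>x\<close>
  and \<open>y\<close> as seen from \<open>\<alpha>\<^sub>k\<close> in the projective plane.\<close>

definition vol :: "real ^ 3 \<Rightarrow> real ^ 3 \<Rightarrow> real ^ 3 \<Rightarrow> real" where
  "vol x y z = x $ 1 * (y $ 2 * z $ 3 - y $ 3 * z $ 2) + x $ 2 * (y $ 3 * z $ 1 - y $ 1 * z $ 3)
    + x $ 3 * (y $ 1 * z $ 2 - y $ 2 * z $ 1)"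

lemma vol_add_left: "vol (x + x') y z = vol x y z + vol x' y z"
  and vol_add_middle: "vol x (y + y') z = vol x y z + vol x y' z"
  and vol_scale_left: "vol (c *\<^sub>R x) y z = c * vol x y z"
  and vol_scale_middle: "vol x (c *\<^sub>R y) z = c * vol x y z"
  and vol_repeat_left: "vol z y z = 0"
  and vol_repeat_right: "vol x z z = 0"
  and vol_repeat: "vol x x z = 0"
  and vol_swap: "vol y x z = - vol x y z"
  by (simp_all add: vol_def algebra_simps)

lemmas vol_simps = vol_add_left vol_add_middle vol_scale_left vol_scale_middle
  vol_repeat_left vol_repeat_right vol_repeat

lemma vol_reflect: "vol (reflect a x) (reflect a y) (reflect a z) = - vol x y z"
proof -
  have *: "reflect a x $ i = (if i = a then 2 * (x $ 1 + x $ 2 + x $ 3) - 3 * x $ a else x $ i)" for x i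
    unfolding reflect_def form_simple_left by (simp add: axis_def)
  show ?thesis
    using exhaust_3[of a] by (auto simp: vol_def * algebra_simps)
qed

lemma vol_act: "vol (act w x) (act w y) (act w z) = (- 1) ^ length w * vol x y z"
  by (induction w) (auto simp: vol_reflect)

abbreviation letter_sign :: "3 \<Rightarrow> 3 \<Rightarrow> real" where
  "letter_sign a b \<equiv> vol (simple_root a) (simple_root b) 1"

text \<open>The sign saying which of the branches \<open>a\<close> and \<open>b\<close> at the vertex \<open>g\<close> comes first in the planar order
  of the tree. Every reflection reverses the orientation of the plane. The all-ones vector in
  \<open>letter_sign\<close> stands for the third letter: the determinant sees only the
  coordinate of that letter.\<close>

definition orientation :: "3 list \<Rightarrow> 3 \<Rightarrow> 3 \<Rightarrow> real" where
  "orientation g a b = (- 1) ^ length g * letter_sign a b"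

lemma letter_sign:
  assumes "a \<noteq> b" "c \<noteq> a" "c \<noteq> b"
  shows "vol (simple_root a) (simple_root b) (simple_root c) = letter_sign a b"
    "letter_sign a c = - letter_sign a b" "letter_sign c b = - letter_sign a b"
    "letter_sign a b = 1 \<or> letter_sign a b = - 1"
  using assms exhaust_3[of a] exhaust_3[of b] exhaust_3[of c]
  by (auto simp: vol_def axis_def)

text \<open>Passing from \<open>h\<close> to a child, the branch that stays at the ideal vertex between \<open>a\<close> and \<open>b\<close> lies on
  the side of the sibling of that child.\<close>

lemma orientation_snoc:
  assumes "a \<noteq> b" "c \<noteq> a" "c \<noteq> b"
  shows "orientation (h @ [b]) a c = orientation h a b"
    "orientation (h @ [a]) c b = orientation h a b"
  using letter_sign[OF assms] by (simp_all add: orientation_def)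

lemma ex_third_letter: "\<exists>c :: 3. c \<noteq> a \<and> c \<noteq> b"
proof -
  have "card {a, b} \<le> 2" by (simp add: card_insert_if)
  then have "{a, b} \<noteq> (UNIV :: 3 set)" using card_num1 by (auto dest: arg_cong[of _ _ card])
  then show ?thesis by blast
qed

lemma orientation_pm: "a \<noteq> b \<Longrightarrow> orientation h a b = 1 \<or> orientation h a b = - 1"
proof -
  assume ab: "a \<noteq> b"
  obtain c :: 3 where "c \<noteq> a" "c \<noteq> b"
    using ex_third_letter by blast
  then show ?thesis
    using letter_sign(4)[OF ab, of c]
    by (cases "even (length h)") (auto simp: orientation_def)
qed

lemma orientation_swap: "orientation h b a = - orientation h a b"
  by (simp add: orientation_def vol_swap[of "simple_root b"])

text \<open>After substituting the excess of each diagonal entry, every negative term of the determinant cancels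
  and the product of the three excesses survives.\<close>

lemma diagonally_dominant_det_pos:
  fixes x2 :: real
  assumes "0 \<le> x2" "0 \<le> x3" "0 \<le> y1" "0 \<le> y3" "0 \<le> z1" "0 \<le> z2"
    and "1 \<le> x1 - x2 - x3" "1 \<le> y2 - y1 - y3" "1 \<le> z3 - z1 - z2"
  shows "0 < x1 * (y2 * z3 - y3 * z2) + x2 * (y3 * z1 - y1 * z3) + x3 * (y1 * z2 - y2 * z1)"
proof -
  define r s t where rst: "r = x1 - x2 - x3" "s = y2 - y1 - y3" "t = z3 - z1 - z2"
  have x: "x1 = x2 + x3 + r" and y: "y2 = y1 + y3 + s" and z: "z3 = z1 + z2 + t"
    by (simp_all add: rst)
  have pos: "1 \<le> r" "1 \<le> s" "1 \<le> t" using assms by (simp_all add: rst)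
  have "x1 * (y2 * z3 - y3 * z2) + x2 * (y3 * z1 - y1 * z3) + x3 * (y1 * z2 - y2 * z1)
     = r * s * t + (x2 * (y3 * (z1 + z1 + t) + s * (z1 + z2 + t)) + x3 * (y1 * (z2 + z2 + t) + y3 * t + s * (z2 + t))
      + r * (y1 * (z1 + z2 + t) + y3 * (z1 + t) + s * (z1 + z2)))"
    unfolding x y z by algebra
  moreover have "0 < r * s * t" using pos by simp
  moreover have "0 \<le> x2 * (y3 * (z1 + z1 + t) + s * (z1 + z2 + t)) + x3 * (y1 * (z2 + z2 + t) + y3 * t + s * (z2 + t))
      + r * (y1 * (z1 + z2 + t) + y3 * (z1 + t) + s * (z1 + z2))"
    using pos assms(1-6) by (intro add_nonneg_nonneg mult_nonneg_nonneg) auto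
  ultimately show ?thesis by linarith
qed

lemma vol_root_different_hds:
  assumes "reduced_word u" "reduced_word v" "reduced_word w"
    and "hd u \<noteq> hd v" "hd w \<noteq> hd u" "hd w \<noteq> hd v"
  shows "0 < vol (root_of u) (root_of v) (root_of w) * letter_sign (hd u) (hd v)"
proof -
  have nn: "0 \<le> root_of u $ i" "0 \<le> root_of v $ i" "0 \<le> root_of w $ i" for i
    using assms(1-3) by (simp_all add: root_nonneg)
  note dom = form_simple_root_hd[OF assms(1), unfolded form_simple_left]
    form_simple_root_hd[OF assms(2), unfolded form_simple_left]
    form_simple_root_hd[OF assms(3), unfolded form_simple_left]
  define x y z where "x = root_of u" "y = root_of v" "z = root_of w"
  consider "hd u = 1" "hd v = 2" "hd w = 3" | "hd u = 1" "hd v = 3" "hd w = 2"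
    | "hd u = 2" "hd v = 1" "hd w = 3" | "hd u = 2" "hd v = 3" "hd w = 1"
    | "hd u = 3" "hd v = 1" "hd w = 2" | "hd u = 3" "hd v = 2" "hd w = 1"
    using assms(4-6) exhaust_3[of "hd u"] exhaust_3[of "hd v"] exhaust_3[of "hd w"] by metis
  then show ?thesis
  proof cases
    case 1
    then show ?thesis
      using diagonally_dominant_det_pos[of "x$2" "x$3" "y$1" "y$3" "z$1" "z$2" "x$1" "y$2" "z$3"] nn dom
      by (simp add: vol_def axis_def x_y_z_def algebra_simps)
  next
    case 2
    then show ?thesis
      using diagonally_dominant_det_pos[of "x$2" "x$3" "z$1" "z$3" "y$1" "y$2" "x$1" "z$2" "y$3"] nn dom
      by (simp add: vol_def axis_def x_y_z_def algebra_simps)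
  next
    case 3
    then show ?thesis
      using diagonally_dominant_det_pos[of "y$2" "y$3" "x$1" "x$3" "z$1" "z$2" "y$1" "x$2" "z$3"] nn dom
      by (simp add: vol_def axis_def x_y_z_def algebra_simps)
  next
    case 4
    then show ?thesis
      using diagonally_dominant_det_pos[of "z$2" "z$3" "x$1" "x$3" "y$1" "y$2" "z$1" "x$2" "y$3"] nn dom
      by (simp add: vol_def axis_def x_y_z_def algebra_simps)
  next
    case 5
    then show ?thesis
      using diagonally_dominant_det_pos[of "y$2" "y$3" "z$1" "z$3" "x$1" "x$2" "y$1" "z$2" "x$3"] nn dom
      by (simp add: vol_def axis_def x_y_z_def algebra_simps)
  next
    case 6
    then show ?thesis
      using diagonally_dominant_det_pos[of "z$2" "z$3" "y$1" "y$3" "x$1" "x$2" "z$1" "y$2" "x$3"] nn dom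
      by (simp add: vol_def axis_def x_y_z_def algebra_simps)
  qed
qed

text \<open>Seen from \<open>\<alpha>\<^sub>k\<close>, all roots of one branch precede all roots of the other. Transporting by the inverse
  of \<open>g\<close> turns the three vectors into roots whose words start with three different letters, and such
  roots form a diagonally dominant matrix.\<close>

lemma branch_order:
  assumes u: "reduced_word (g @ a # u)" and v: "reduced_word (g @ b # v)" and "a \<noteq> b"
    and "hd (g @ [a]) \<noteq> k" "hd (g @ [b]) \<noteq> k"
  shows "0 < vol (root_of (g @ a # u)) (root_of (g @ b # v)) (simple_root k) * orientation g a b"
proof -
  define w where "w = rev g @ [k]"
  have w: "reduced_word w" "hd w \<noteq> a" "hd w \<noteq> b"
    using assms by (auto simp: w_def distinct_adj_append_iff hd_append last_rev hd_rev)
  have "simple_root k = act g (act (rev g) (root_of [k]))"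
    by (simp add: act_act_rev)
  also have "act (rev g) (root_of [k]) = root_of w"
    by (simp add: w_def root_append)
  finally have "vol (root_of (g @ a # u)) (root_of (g @ b # v)) (simple_root k)
      = (- 1) ^ length g * vol (root_of (a # u)) (root_of (b # v)) (root_of w)"
    by (simp add: root_append vol_act del: root_of.simps)
  moreover have "0 < vol (root_of (a # u)) (root_of (b # v)) (root_of w) * letter_sign a b"
    using vol_root_different_hds[of "a # u" "b # v" w] u v w assms(3)
    by (auto simp: distinct_adj_append_iff simp del: root_of.simps)
  ultimately show ?thesis
    by (cases "even (length g)") (simp_all add: orientation_def del: root_of.simps)
qed

section \<open>Fans\<close>

fun alternating :: "3 \<Rightarrow> 3 \<Rightarrow> nat \<Rightarrow> 3 list" where
  "alternating p q 0 = []"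
| "alternating p q (Suc n) = p # alternating q p n"

lemma alternating_eq_Nil_iff [simp]: "alternating p q n = [] \<longleftrightarrow> n = 0"
  by (cases n) auto

lemma hd_alternating: "n \<noteq> 0 \<Longrightarrow> hd (alternating p q n) = p"
  by (cases n) auto

lemma distinct_adj_alternating: "p \<noteq> q \<Longrightarrow> distinct_adj (alternating p q n)"
  by (induction n arbitrary: p q) (auto simp: distinct_adj_Cons hd_alternating)

lemma alternating_snoc: "alternating p q (Suc n) = alternating p q n @ [if even n then p else q]"
  by (induction n arbitrary: p q) auto

lemma root_alternating:
  assumes "p \<noteq> q"
  shows "root_of (alternating p q (Suc n))
    = (real n + 1) *\<^sub>R simple_root p + real n *\<^sub>R simple_root q"
  using assms
proof (induction n arbitrary: p q)
  case (Suc n)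
  then have "root_of (alternating p q (Suc (Suc n)))
      = reflect p ((real n + 1) *\<^sub>R simple_root q + real n *\<^sub>R simple_root p)"
    by (subst alternating.simps) simp
  also have "\<dots> = (real (Suc n) + 1) *\<^sub>R simple_root p + real (Suc n) *\<^sub>R simple_root q"
    using Suc.prems by (simp add: reflect_def form_simps form_simple_root algebra_simps)
  finally show ?case .
qed simp

abbreviation fan_word :: "3 list \<Rightarrow> 3 \<Rightarrow> 3 \<Rightarrow> nat \<Rightarrow> 3 list" where
  "fan_word w p q n \<equiv> w @ alternating p q (Suc n)"

lemma root_fan_word:
  assumes "p \<noteq> q"
  shows "root_of (fan_word w p q n)
    = (real n + 1) *\<^sub>R root_of (w @ [p]) + real n *\<^sub>R root_of (w @ [q])"
proof -
  have "root_of (fan_word w p q n) = act w (root_of (alternating p q (Suc n)))"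
    by (rule root_append) simp
  also have "\<dots> = (real n + 1) *\<^sub>R act w (root_of [p]) + real n *\<^sub>R act w (root_of [q])"
    unfolding root_alternating[OF assms] by (simp add: linear_add[OF linear_act] linear_cmul[OF linear_act])
  finally show ?thesis by (simp only: root_append list.distinct not_False_eq_True)
qed

text \<open>Among the triangles meeting at an ideal vertex, the one at \<open>w\<close> is nearest to the base triangle; the
  fan leaves \<open>w\<close> in the two directions \<open>p\<close> and \<open>q\<close>.\<close>

definition fan_apex :: "3 list \<Rightarrow> 3 \<Rightarrow> 3 \<Rightarrow> bool" where
  "fan_apex w p q \<longleftrightarrow> p \<noteq> q \<and> distinct_adj w \<and> (w = [] \<or> last w \<noteq> p \<and> last w \<noteq> q)"

lemma reduced_fan_word: "fan_apex w p q \<Longrightarrow> reduced_word (fan_word w p q n)"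
  using distinct_adj_alternating[of p q "Suc n"]
  by (auto simp: fan_apex_def distinct_adj_append_iff)

text \<open>The directions in a fan follow each other as \<open>p, pq, pqp, \<dots>\<close> and then, past the ideal vertex in the
  limit, \<open>\<dots>, qpq, qp, q\<close>. So a word on one side lies between any earlier word on that side and any
  word on the other side.\<close>

lemma fan_between_opposite:
  assumes "fan_apex w p q" "n \<le> m"
  shows "\<exists>a b. 0 \<le> a \<and> 0 \<le> b \<and> root_of (fan_word w p q m)
    = a *\<^sub>R root_of (fan_word w p q n) + b *\<^sub>R root_of (fan_word w q p l)"
proof -
  have pq: "p \<noteq> q" using assms by (simp add: fan_apex_def)
  \<comment> \<open>The coefficients solve the two linear equations for the basis roots of the fan; \<open>s\<close> is their determinant.\<close>
  define s where "s = real n + real l + 1"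
  have s: "0 < s" by (simp add: s_def)
  define a b where ab: "a = (real m + real l + 1) / s" "b = (real m - real n) / s"
  have as: "a * s = real m + real l + 1" and bs: "b * s = real m - real n"
    using s by (simp_all add: ab)
  have "s * (a * (real n + 1) + b * real l) = (a * s) * (real n + 1) + (b * s) * real l"
    "s * (a * real n + b * (real l + 1)) = (a * s) * real n + (b * s) * (real l + 1)"
    by (simp_all add: algebra_simps)
  then have "s * (a * (real n + 1) + b * real l) = s * (real m + 1)"
    "s * (a * real n + b * (real l + 1)) = s * real m"
    unfolding as bs by (simp_all add: s_def algebra_simps)
  then have coeffs: "a * (real n + 1) + b * real l = real m + 1" "a * real n + b * (real l + 1) = real m"
    using s by simp_all
  have combine: "(real m + 1) *\<^sub>R x + real m *\<^sub>R y
      = a *\<^sub>R ((real n + 1) *\<^sub>R x + real n *\<^sub>R y) + b *\<^sub>R ((real l + 1) *\<^sub>R y + real l *\<^sub>R x)"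
    for x y :: "real ^ 3"
  proof -
    have "a *\<^sub>R ((real n + 1) *\<^sub>R x + real n *\<^sub>R y) + b *\<^sub>R ((real l + 1) *\<^sub>R y + real l *\<^sub>R x)
        = (a * (real n + 1) + b * real l) *\<^sub>R x + (a * real n + b * (real l + 1)) *\<^sub>R y"
      by (simp add: algebra_simps)
    then show ?thesis using coeffs by simp
  qed
  have "root_of (fan_word w p q m)
      = a *\<^sub>R root_of (fan_word w p q n) + b *\<^sub>R root_of (fan_word w q p l)"
    unfolding root_fan_word[OF pq] root_fan_word[OF pq[symmetric]]
    by (rule combine)
  moreover have "0 \<le> a" "0 \<le> b" using assms s by (simp_all add: ab)
  ultimately show ?thesis by blast
qed

section \<open>Closed sets of words\<close>

definition closed_words :: "(3 list \<Rightarrow> bool) \<Rightarrow> bool" where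
  "closed_words S \<longleftrightarrow> (\<forall>w. S w \<longrightarrow> reduced_word w) \<and>
    (\<forall>u v w a b. S u \<longrightarrow> S v \<longrightarrow> reduced_word w \<longrightarrow> 0 \<le> a \<longrightarrow> 0 \<le> b \<longrightarrow>
      root_of w = a *\<^sub>R root_of u + b *\<^sub>R root_of v \<longrightarrow> S w)"

lemma closed_wordsD:
  "closed_words S \<Longrightarrow> S u \<Longrightarrow> S v \<Longrightarrow> reduced_word w \<Longrightarrow> 0 \<le> a \<Longrightarrow> 0 \<le> b \<Longrightarrow>
    root_of w = a *\<^sub>R root_of u + b *\<^sub>R root_of v \<Longrightarrow> S w"
  unfolding closed_words_def by blast

lemma closed_words_fan:
  assumes "closed_words S" "fan_apex w p q" "n \<le> m" "S (fan_word w p q n)" "S (fan_word w q p l)"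
  shows "S (fan_word w p q m)"
proof -
  obtain a b where "0 \<le> a" "0 \<le> b" "root_of (fan_word w p q m)
      = a *\<^sub>R root_of (fan_word w p q n) + b *\<^sub>R root_of (fan_word w q p l)"
    using fan_between_opposite[OF assms(2,3)] by blast
  then show ?thesis
    by (intro closed_wordsD[OF assms(1,4,5)] reduced_fan_word assms(2))
qed

lemma three_letters: "a \<noteq> b \<Longrightarrow> c \<noteq> a \<Longrightarrow> c \<noteq> b \<Longrightarrow> d = a \<or> d = b \<or> d = (c :: 3)"
  using exhaust_3[of a] exhaust_3[of b] exhaust_3[of c] exhaust_3[of d] by auto

definition subtree :: "(3 list \<Rightarrow> bool) \<Rightarrow> 3 list \<Rightarrow> bool" where
  "subtree S h \<longleftrightarrow> (\<forall>w. reduced_word w \<longrightarrow> prefix h w \<longrightarrow> S w)"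

text \<open>Membership in \<open>S\<close> of all words that extend \<open>h\<close> inside the two fans containing the edge that ends
  in \<open>h\<close>.\<close>

definition rays :: "(3 list \<Rightarrow> bool) \<Rightarrow> 3 list \<Rightarrow> bool" where
  "rays S h \<longleftrightarrow> (\<forall>a n. a \<noteq> last h \<longrightarrow> S (h @ alternating a (last h) (Suc n)))"

text \<open>Of the three fans at \<open>h\<close>, two are covered by the assumption, and the third is generated by the two edges
  leaving \<open>h\<close>. These three fans contain the rays of both children, so the property propagates down the
  tree.\<close>

lemma rays_imp:
  assumes "closed_words S" "reduced_word h" "rays S h" "reduced_word (h @ z)" "z \<noteq> []"
  shows "S (h @ z)"
  using assms(2-)
proof (induction z arbitrary: h)
  case (Cons a z)
  have ah: "a \<noteq> last h" using Cons.prems by (auto simp: distinct_adj_append_iff)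
  have hS: "S (h @ [b])" if "b \<noteq> last h" for b
  proof -
    have "S (h @ alternating b (last h) (Suc 0))"
      using Cons.prems(2) that unfolding rays_def by blast
    then show ?thesis by simp
  qed
  show ?case
  proof (cases "z = []")
    case True
    then show ?thesis using hS[OF ah] by simp
  next
    case False
    have "rays S (h @ [a])"
      unfolding rays_def
    proof (intro allI impI)
      fix b n assume "b \<noteq> last (h @ [a])"
      then have ba: "b \<noteq> a" by simp
      have eq: "(h @ [a]) @ alternating b (last (h @ [a])) (Suc n) = fan_word h a b (Suc n)"
        by simp
      show "S ((h @ [a]) @ alternating b (last (h @ [a])) (Suc n))"
      proof (cases "b = last h")
        case True
        then show ?thesis
          using Cons.prems(2) ah unfolding eq rays_def by blast
      next
        case False
        have "fan_apex h a b"
          using Cons.prems(1) ah ba False by (auto simp: fan_apex_def)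
        then show ?thesis unfolding eq
          using hS[OF ah] hS[OF False] closed_words_fan[OF assms(1), of h a b 0 "Suc n" 0] by simp
      qed
    qed
    then have "S ((h @ [a]) @ z)"
      using Cons.prems False by (intro Cons.IH) (auto simp: distinct_adj_append_iff)
    then show ?thesis by simp
  qed
qed simp

section \<open>Pivots\<close>

text \<open>The edge ending in \<open>h\<close> and the edge from \<open>h\<close> to \<open>h @ [a]\<close> belong to a common fan, whose ideal vertex
  is the pivot when turning from \<open>h\<close> to \<open>a\<close>. The predicate asks for an element of \<open>S\<close> on the other side
  of this fan. The letter \<open>c\<close> is the one with which the fan continues after \<open>h @ [a]\<close>; it is the last
  letter of \<open>h\<close>, except at the root of the tree (\<open>n = 0\<close>), where it is a letter chosen in advance.\<close>

definition pivot :: "(3 list \<Rightarrow> bool) \<Rightarrow> 3 list \<Rightarrow> 3 \<Rightarrow> 3 \<Rightarrow> bool" where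
  "pivot S h c a \<longleftrightarrow> (\<exists>w p q n l. fan_apex w p q \<and> h = w @ alternating p q n \<and> (n = 0 \<longrightarrow> h = [])
    \<and> a = (if even n then p else q) \<and> c = (if even n then q else p) \<and> S (fan_word w q p l))"

lemma alternating_add:
  "alternating p q (n + m) = alternating p q n @ (if even n then alternating p q m else alternating q p m)"
  by (induction n arbitrary: p q) auto

lemma pivot_ray:
  assumes "closed_words S" "pivot S h c a" "S (h @ [a])"
  shows "S (h @ alternating a c (Suc m))"
proof -
  obtain w p q n l where *: "fan_apex w p q" "h = w @ alternating p q n"
    "a = (if even n then p else q)" "c = (if even n then q else p)" "S (fan_word w q p l)"
    using assms(2) unfolding pivot_def by blast
  have "h @ alternating a c (Suc j) = fan_word w p q (n + j)" for j
    using alternating_add[of p q n "Suc j"] * by (simp del: alternating.simps)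
  from this[of m] this[of 0] show ?thesis
    using closed_words_fan[OF assms(1) *(1), of n "n + m" l] *(5) assms(3) by simp
qed

lemma pivot_extend: "pivot S h c a \<Longrightarrow> pivot S (h @ [a]) a c"
  unfolding pivot_def
  apply (elim exE conjE)
  subgoal for w p q n l
    by (intro exI[of _ w] exI[of _ p] exI[of _ q] exI[of _ "Suc n"] exI[of _ l])
       (auto simp: alternating_snoc simp del: alternating.simps)
  done

lemma pivot_start: "fan_apex h a b \<Longrightarrow> S (fan_word h b a l) \<Longrightarrow> pivot S (h @ [a]) a b"
  unfolding pivot_def
  by (intro exI[of _ h] exI[of _ a] exI[of _ b] exI[of _ 1] exI[of _ l]) auto

text \<open>The edge from \<open>h\<close> to \<open>h @ [a]\<close> lies in the fan between the edge before it and the element on the other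
  side.\<close>

lemma pivot_step:
  assumes "closed_words S" "pivot S h c a" "h \<noteq> []" "S h"
  shows "S (h @ [a])"
proof -
  obtain w p q n l where *: "fan_apex w p q" "h = w @ alternating p q n" "n = 0 \<longrightarrow> h = []"
    "a = (if even n then p else q)" "S (fan_word w q p l)"
    using assms(2) unfolding pivot_def by blast
  then obtain j where j: "n = Suc j" using assms(3) by (cases n) auto
  have "h = fan_word w p q j" "h @ [a] = fan_word w p q n"
    using * j alternating_snoc[of p q n] by (simp_all del: alternating.simps)
  then show ?thesis
    using closed_words_fan[OF assms(1) *(1), of j n l] assms(4) *(5) j by simp
qed

lemma subtreeI:
  assumes "closed_words S" "pivot S h c a" "a \<noteq> b" "c \<noteq> a" "c \<noteq> b" "reduced_word (h @ [a])"
    and E: "\<And>n. S (fan_word h a b n)"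
  shows "subtree S (h @ [a])"
  unfolding subtree_def
proof (intro allI impI)
  fix w assume w: "reduced_word w" "prefix (h @ [a]) w"
  then obtain z where z: "w = (h @ [a]) @ z" by (auto simp: prefix_def)
  have S0: "S (h @ [a])" using E[of 0] by simp
  have "rays S (h @ [a])"
    unfolding rays_def
  proof (intro allI impI)
    fix d n assume "d \<noteq> last (h @ [a])"
    then consider "d = b" | "d = c" using three_letters[OF assms(3-5), of d] by auto
    then show "S ((h @ [a]) @ alternating d (last (h @ [a])) (Suc n))"
    proof cases
      case 1
      then show ?thesis using E[of "Suc n"] by simp
    next
      case 2
      then show ?thesis using pivot_ray[OF assms(1,2) S0, of "Suc n"] by simp
    qed
  qed
  then show "S w"
    using rays_imp[OF assms(1,6), of z] w S0 unfolding z by (cases "z = []") auto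
qed

section \<open>Closures of coclosed sets do not cross their complement\<close>

text \<open>Let \<open>S\<close> hold behind the pivot on side \<open>a\<close> and \<open>T\<close> behind the pivot on side \<open>b\<close> of \<open>h\<close>. Of any two words
  branching below \<open>h\<close>, the one on the \<open>a\<close>-side is in \<open>S\<close> or the one on the \<open>b\<close>-side is in \<open>T\<close>. Equality
  of orientations expresses that the sides correspond.\<close>

definition branches_separated :: "(3 list \<Rightarrow> bool) \<Rightarrow> (3 list \<Rightarrow> bool) \<Rightarrow> bool" where
  "branches_separated S T \<longleftrightarrow> (\<forall>h z c a b a' b' u v. reduced_word h \<longrightarrow> c = last h \<longrightarrow> a \<noteq> b \<longrightarrow> c \<noteq> a \<longrightarrow> c \<noteq> b \<longrightarrow>
    pivot S h c a \<longrightarrow> pivot T h c b \<longrightarrow>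
    reduced_word (h @ z @ a' # u) \<longrightarrow> reduced_word (h @ z @ b' # v) \<longrightarrow>
    a' \<noteq> b' \<longrightarrow> orientation (h @ z) a' b' = orientation h a b \<longrightarrow> S (h @ z @ a' # u) \<or> T (h @ z @ b' # v))"

lemma branches_separatedD:
  "branches_separated S T \<Longrightarrow> reduced_word h \<Longrightarrow> a \<noteq> b \<Longrightarrow> last h \<noteq> a \<Longrightarrow> last h \<noteq> b \<Longrightarrow>
    pivot S h (last h) a \<Longrightarrow> pivot T h (last h) b \<Longrightarrow>
    reduced_word (h @ z @ a' # u) \<Longrightarrow> reduced_word (h @ z @ b' # v) \<Longrightarrow> a' \<noteq> b' \<Longrightarrow>
    orientation (h @ z) a' b' = orientation h a b \<Longrightarrow> S (h @ z @ a' # u) \<or> T (h @ z @ b' # v)"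
  unfolding branches_separated_def by blast

text \<open>Exchanging the two sides reverses both orientations.\<close>

lemma branches_separated_commute:
  assumes "branches_separated S T"
  shows "branches_separated T S"
  unfolding branches_separated_def
proof (intro allI impI)
  fix h z c a b a' b' u v
  assume *: "reduced_word h" "c = last h" "a \<noteq> b" "c \<noteq> a" "c \<noteq> b" "pivot T h c a" "pivot S h c b"
    "reduced_word (h @ z @ a' # u)" "reduced_word (h @ z @ b' # v)" "a' \<noteq> b'"
    "orientation (h @ z) a' b' = orientation h a b"
  then have "orientation (h @ z) b' a' = orientation h b a"
    by (simp add: orientation_swap[of h b] orientation_swap[of _ b'])
  then show "T (h @ z @ a' # u) \<or> S (h @ z @ b' # v)"
    using assms * unfolding branches_separated_def by metis
qed

lemma ordered_decomposition:
  assumes "reduced_word u" "reduced_word v" "prefix g u" "prefix g v" "u \<parallel> v"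
    and "hd u \<noteq> k" "hd v \<noteq> k" and "0 < vol (root_of u) (root_of v) (simple_root k)"
  shows "\<exists>z a b u' v'. a \<noteq> b \<and> u = g @ z @ a # u' \<and> v = g @ z @ b # v' \<and> orientation (g @ z) a b = 1"
proof -
  obtain f a u' b v' where ab: "a \<noteq> b" and u: "u = f @ a # u'" and v: "v = f @ b # v'"
    using parallel_decomp[OF assms(5)] by blast
  have "prefix g f"
  proof (rule ccontr)
    assume ng: "\<not> prefix g f"
    have "prefix f u" by (simp add: u)
    then have "prefix f g" using prefix_same_cases[OF _ assms(3)] ng by blast
    then have "strict_prefix f g" using ng by (auto simp: strict_prefix_def)
    then obtain d r where "g = f @ d # r" by (auto elim: strict_prefixE')
    then show False using assms(3,4) ab unfolding u v by auto
  qed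
  then obtain z where f: "f = g @ z" by (auto simp: prefix_def)
  have "hd (f @ [a]) \<noteq> k" "hd (f @ [b]) \<noteq> k"
    using assms(6,7) unfolding u v by (cases f; simp)+
  then have "0 < vol (root_of u) (root_of v) (simple_root k) * orientation f a b"
    using branch_order[of f a u' b v' k] assms(1,2) ab unfolding u v by blast
  then have "orientation f a b = 1"
    using assms(8) orientation_pm[OF ab, of f] by auto
  then show ?thesis using ab u v f by auto
qed

text \<open>The words \<open>u\<close>, \<open>v\<close>, \<open>w\<close> follow each other in the planar order. Say that \<open>S\<close> guards a side of a vertex
  if \<open>pivot S\<close> holds on that side; \<open>S\<close> guards \<open>h\<close> on both sides. As long as one branch lies entirely in \<open>S\<close>, the outer words \<open>u\<close>, \<open>w\<close> and therefore also \<open>v\<close>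
  are in the other branch, which is again guarded on both sides. Otherwise the fan between the
  branches has elements of \<open>T\<close> on both sides, so each branch is guarded by \<open>S\<close> outside and by \<open>T\<close>
  inside, and \<open>v\<close> together with the outer word of its branch contradicts \<open>branches_separated\<close>.\<close>

lemma no_alternation:
  assumes S: "closed_words S" and cover: "\<And>w. reduced_word w \<Longrightarrow> S w \<or> T w"
    and cf: "branches_separated S T"
    and "a \<noteq> b" "c \<noteq> a" "c \<noteq> b" "h \<noteq> [] \<Longrightarrow> c = last h" "distinct_adj h"
    and "hd (h @ [a]) \<noteq> k" "hd (h @ [b]) \<noteq> k"
    and "pivot S h c a" "pivot S h c b" "orientation h a b = 1"
    and "reduced_word u" "reduced_word v" "reduced_word w" "u \<parallel> v" "v \<parallel> w"
    and "prefix (h @ [a]) u \<or> prefix (h @ [b]) u"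
    and "prefix (h @ [a]) v \<or> prefix (h @ [b]) v"
    and "prefix (h @ [a]) w \<or> prefix (h @ [b]) w"
    and "\<not> S u" "\<not> T v" "\<not> S w"
    and "0 < vol (root_of u) (root_of v) (simple_root k)"
    and "0 < vol (root_of v) (root_of w) (simple_root k)"
  shows False
  using assms(4-)
proof (induction "length v - length h" arbitrary: h a b c rule: less_induct)
  case less
  note letters = less.prems(1-3)
  note last_h = less.prems(4)
  note dh = less.prems(5)
  note hdk = less.prems(6,7)
  note piv = less.prems(8,9)
  note ori = less.prems(10)
  note red = less.prems(11-13)
  note par = less.prems(14,15)
  note pre = less.prems(16-18)
  note notin = less.prems(19-21)
  note order = less.prems(22,23)
  have lh: "h = [] \<or> last h \<noteq> a \<and> last h \<noteq> b" using last_h letters by auto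
  have apex: "fan_apex h a b" "fan_apex h b a"
    using letters(1) dh lh by (auto simp: fan_apex_def)
  have ra: "reduced_word (h @ [a])" and rb: "reduced_word (h @ [b])"
    using dh lh by (auto simp: distinct_adj_append_iff)
  have ab_order: False if p: "prefix (h @ [a]) x" "prefix (h @ [b]) y" "reduced_word x" "reduced_word y"
    and "0 < vol (root_of y) (root_of x) (simple_root k)" for x y
  proof -
    obtain x' y' where xy: "x = h @ a # x'" "y = h @ b # y'" using p by (auto simp: prefix_def)
    have "0 < vol (root_of x) (root_of y) (simple_root k)"
      using branch_order[of h a x' b y' k] p(3,4) letters(1) hdk ori unfolding xy by simp
    then show False using that(5) vol_swap[of "root_of y" "root_of x"] by simp
  qed
  have hd_nk: "hd x \<noteq> k" if "prefix (h @ [a]) x \<or> prefix (h @ [b]) x" for x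
    using that hdk by (cases h) (auto simp: prefix_def)
  note orient = orientation_snoc[OF letters, of h]
  have len: "length h < length v"
    using pre(2) by (auto dest: prefix_length_le)
  have proper: "\<exists>d. d \<noteq> e \<and> prefix ((h @ [e]) @ [d]) x"
    if p: "prefix (h @ [e]) x" "prefix (h @ [e]) y" "x \<parallel> y" "reduced_word x" for x y e
  proof -
    obtain x' where x: "x = h @ e # x'" using p(1) by (auto simp: prefix_def)
    have "x' \<noteq> []" using p(2,3) by (auto simp: x parallel_def)
    then obtain d x'' where "x' = d # x''" by (cases x') auto
    then show ?thesis using p(4) by (auto simp: x distinct_adj_append_iff)
  qed
  show False
  proof (cases "\<forall>l. S (fan_word h b a l)")
    case True
    have sb: "subtree S (h @ [b])"
      using subtreeI[OF S piv(2) letters(1)[symmetric] letters(3,2) rb] True by blast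
    have ua: "prefix (h @ [a]) u" and wa: "prefix (h @ [a]) w"
      using sb pre(1,3) notin(1,3) red(1,3) unfolding subtree_def by blast+
    have va: "prefix (h @ [a]) v"
      using pre(2) ab_order[OF wa _ red(3,2)] order(2) by blast
    have ext: "prefix ((h @ [a]) @ [c]) x \<or> prefix ((h @ [a]) @ [b]) x"
      if p: "prefix (h @ [a]) x" "prefix (h @ [a]) y" "x \<parallel> y" "reduced_word x" for x y
    proof -
      obtain d where d: "d \<noteq> a" "prefix ((h @ [a]) @ [d]) x" using proper[OF p] by blast
      then show ?thesis using three_letters[OF letters, of d] by blast
    qed
    show False
    proof (rule less.hyps[of "h @ [a]" c b a])
      show "length v - length (h @ [a]) < length v - length h" using len by simp
      show "pivot S (h @ [a]) a c" by (rule pivot_extend[OF piv(1)])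
      show "pivot S (h @ [a]) a b" using pivot_start[OF apex(1), of S 0] True by blast
      show "prefix ((h @ [a]) @ [c]) u \<or> prefix ((h @ [a]) @ [b]) u"
        using ext[OF ua va par(1) red(1)] .
      show "prefix ((h @ [a]) @ [c]) v \<or> prefix ((h @ [a]) @ [b]) v"
        using ext[OF va wa par(2) red(2)] .
      show "prefix ((h @ [a]) @ [c]) w \<or> prefix ((h @ [a]) @ [b]) w"
        using ext[OF wa va _ red(3)] par(2) parallel_commute by blast
      show "hd ((h @ [a]) @ [c]) \<noteq> k" "hd ((h @ [a]) @ [b]) \<noteq> k"
        using hdk(1) by (cases h; simp)+
      show "orientation (h @ [a]) c b = 1" using orient ori by simp
    qed (use letters ra red par notin order in auto)
  next
    case nb: False
    show False
    proof (cases "\<forall>l. S (fan_word h a b l)")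
      case True
      have sa: "subtree S (h @ [a])"
        using subtreeI[OF S piv(1) letters ra] True by blast
      have ub: "prefix (h @ [b]) u" and wb: "prefix (h @ [b]) w"
        using sa pre(1,3) notin(1,3) red(1,3) unfolding subtree_def by blast+
      have vb: "prefix (h @ [b]) v"
        using pre(2) ab_order[OF _ ub red(2,1)] order(1) by blast
      have ext: "prefix ((h @ [b]) @ [a]) x \<or> prefix ((h @ [b]) @ [c]) x"
        if p: "prefix (h @ [b]) x" "prefix (h @ [b]) y" "x \<parallel> y" "reduced_word x" for x y
      proof -
        obtain d where d: "d \<noteq> b" "prefix ((h @ [b]) @ [d]) x" using proper[OF p] by blast
        then show ?thesis using three_letters[OF letters, of d] by blast
      qed
      show False
      proof (rule less.hyps[of "h @ [b]" a c b])
        show "length v - length (h @ [b]) < length v - length h" using len by simp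
        show "pivot S (h @ [b]) b c" by (rule pivot_extend[OF piv(2)])
        show "pivot S (h @ [b]) b a" using pivot_start[OF apex(2), of S 0] True by blast
        show "prefix ((h @ [b]) @ [a]) u \<or> prefix ((h @ [b]) @ [c]) u"
          using ext[OF ub vb par(1) red(1)] .
        show "prefix ((h @ [b]) @ [a]) v \<or> prefix ((h @ [b]) @ [c]) v"
          using ext[OF vb wb par(2) red(2)] .
        show "prefix ((h @ [b]) @ [a]) w \<or> prefix ((h @ [b]) @ [c]) w"
          using ext[OF wb vb _ red(3)] par(2) parallel_commute by blast
        show "hd ((h @ [b]) @ [a]) \<noteq> k" "hd ((h @ [b]) @ [c]) \<noteq> k"
          using hdk(2) by (cases h; simp)+
        show "orientation (h @ [b]) a c = 1" using orient ori by simp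
      qed (use letters rb red par notin order in auto)
    next
      case na: False
      obtain l m where T: "T (fan_word h a b l)" "T (fan_word h b a m)"
        using na nb cover reduced_fan_word[OF apex(1)] reduced_fan_word[OF apex(2)] by blast
      from pre(2) show False
      proof
        assume va: "prefix (h @ [a]) v"
        have ua: "prefix (h @ [a]) u"
          using pre(1) ab_order[OF va _ red(2,1)] order(1) by blast
        obtain z a' b' u' v' where z: "a' \<noteq> b'" "u = (h @ [a]) @ z @ a' # u'" "v = (h @ [a]) @ z @ b' # v'"
          "orientation ((h @ [a]) @ z) a' b' = 1"
          using ordered_decomposition[OF red(1,2) ua va par(1) _ _ order(1)] hd_nk pre(1,2) by blast
        have "pivot S (h @ [a]) a c" by (rule pivot_extend[OF piv(1)])
        moreover have "pivot T (h @ [a]) a b" using pivot_start[OF apex(1), of T m] T by blast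
        moreover have "reduced_word ((h @ [a]) @ z @ a' # u')" "reduced_word ((h @ [a]) @ z @ b' # v')"
          using red(1,2) z(2,3) by simp_all
        moreover have "orientation ((h @ [a]) @ z) a' b' = orientation (h @ [a]) c b"
          using z(4) orient(2) ori by simp
        ultimately have "S ((h @ [a]) @ z @ a' # u') \<or> T ((h @ [a]) @ z @ b' # v')"
          using branches_separatedD[OF cf ra, of c b z a' u' b' v'] letters z(1) by simp
        then have "S u \<or> T v" using z(2,3) by simp
        then show False using notin by blast
      next
        assume vb: "prefix (h @ [b]) v"
        have wb: "prefix (h @ [b]) w"
          using pre(3) ab_order[OF _ vb red(3,2)] order(2) by blast
        obtain z a' b' u' v' where z: "a' \<noteq> b'" "v = (h @ [b]) @ z @ a' # u'" "w = (h @ [b]) @ z @ b' # v'"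
          "orientation ((h @ [b]) @ z) a' b' = 1"
          using ordered_decomposition[OF red(2,3) vb wb par(2) _ _ order(2)] hd_nk pre(2,3) by blast
        have "pivot S (h @ [b]) b c" by (rule pivot_extend[OF piv(2)])
        moreover have "pivot T (h @ [b]) b a" using pivot_start[OF apex(2), of T l] T by blast
        moreover have "reduced_word ((h @ [b]) @ z @ a' # u')" "reduced_word ((h @ [b]) @ z @ b' # v')"
          using red(2,3) z(2,3) by simp_all
        moreover have "orientation ((h @ [b]) @ z) a' b' = orientation (h @ [b]) a c"
          using z(4) orient(1) ori by simp
        ultimately have "T ((h @ [b]) @ z @ a' # u') \<or> S ((h @ [b]) @ z @ b' # v')"
          using branches_separatedD[OF branches_separated_commute[OF cf] rb, of a c z a' u' b' v'] letters z(1) by simp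
        then have "T v \<or> S w" using z(2,3) by simp
        then show False using notin by blast
      qed
    qed
  qed
qed

locale coclosed_closure =
  fixes X C :: "3 list \<Rightarrow> bool"
  assumes coclosed: "closed_words (\<lambda>w. reduced_word w \<and> \<not> X w)"
    and closed: "closed_words C"
    and X_imp_C: "X w \<Longrightarrow> C w"
begin

abbreviation nX :: "3 list \<Rightarrow> bool" where
  "nX w \<equiv> reduced_word w \<and> \<not> X w"

lemma C_reduced: "C w \<Longrightarrow> reduced_word w"
  using closed by (simp add: closed_words_def)

text \<open>If the first edge of branch \<open>b\<close> is in \<open>X\<close>, then coclosedness at the pivot in \<open>nX\<close> puts the edge
  before \<open>h\<close> in \<open>X\<close>, and the pivot in \<open>C\<close> puts the first edge of branch \<open>a\<close> in \<open>C\<close>; now the fan between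
  the branches is in \<open>C\<close>. If that edge is not in \<open>X\<close>, then either the \<open>a\<close>-side of this fan is contained
  in \<open>X\<close>, or some word on it is not, and then the whole \<open>b\<close>-side is outside \<open>X\<close>.\<close>

lemma branch_dichotomy:
  assumes "reduced_word h" "c = last h" "a \<noteq> b" "c \<noteq> a" "c \<noteq> b" "pivot C h c a" "pivot nX h c b"
  shows "subtree C (h @ [a]) \<or> subtree nX (h @ [b])"
proof -
  have apex: "fan_apex h a b" "fan_apex h b a"
    using assms by (auto simp: fan_apex_def)
  have ra: "reduced_word (h @ [a])" and rb: "reduced_word (h @ [b])"
    using assms by (auto simp: distinct_adj_append_iff)
  show ?thesis
  proof (cases "X (h @ [b])")
    case True
    have "X h"
      using pivot_step[OF coclosed assms(7)] assms(1) True by blast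
    then have "C (h @ [a])"
      using pivot_step[OF closed assms(6)] assms(1) X_imp_C by blast
    then have "C (fan_word h a b n)" for n
      using closed_words_fan[OF closed apex(1), of 0 n 0] X_imp_C[OF True] by simp
    then show ?thesis
      using subtreeI[OF closed assms(6,3-5) ra] by blast
  next
    case False
    then have b0: "nX (fan_word h b a 0)" using rb by simp
    show ?thesis
    proof (cases "\<forall>n. X (fan_word h a b n)")
      case True
      then show ?thesis
        using subtreeI[OF closed assms(6,3-5) ra] X_imp_C by blast
    next
      case False
      then obtain n where "nX (fan_word h a b n)"
        using reduced_fan_word[OF apex(1)] by blast
      then have "nX (fan_word h b a l)" for l
        using closed_words_fan[OF coclosed apex(2) _ b0, of l n] by blast
      then show ?thesis
        using subtreeI[OF coclosed assms(7) assms(3)[symmetric] assms(5,4) rb] by blast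
    qed
  qed
qed

text \<open>Walk from \<open>h\<close> towards the vertex where the two words part. By the dichotomy either one of the words
  is settled, or the walk turns away from the branch that was decided, and this branch guards the
  next vertex.\<close>

lemma branches_separated_closure: "branches_separated C nX"
  unfolding branches_separated_def
proof (intro allI impI)
  fix h z :: "3 list" and c a b a' b' :: 3 and u v :: "3 list"
  assume "reduced_word h" "c = last h" "a \<noteq> b" "c \<noteq> a" "c \<noteq> b" "pivot C h c a" "pivot nX h c b"
    "reduced_word (h @ z @ a' # u)" "reduced_word (h @ z @ b' # v)"
    "a' \<noteq> b'" "orientation (h @ z) a' b' = orientation h a b"
  then show "C (h @ z @ a' # u) \<or> nX (h @ z @ b' # v)"
  proof (induction z arbitrary: h a b c)
    case Nil
    have "a' \<noteq> c" "b' \<noteq> c"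
      using Nil.prems by (auto simp: distinct_adj_append_iff)
    then have "a' = a \<and> b' = b \<or> a' = b \<and> b' = a"
      using three_letters[OF Nil.prems(3-5)] Nil.prems(10) by metis
    moreover have "\<not> (a' = b \<and> b' = a)"
      using Nil.prems(11) orientation_swap[of h a b] orientation_pm[OF Nil.prems(3), of h] by auto
    ultimately have ab: "a' = a" "b' = b" by auto
    show ?case
      using branch_dichotomy[OF Nil.prems(1-7)] Nil.prems(8,9)
      unfolding subtree_def ab by (auto simp: prefix_def)
  next
    case (Cons d z)
    have apex: "fan_apex h a b" "fan_apex h b a"
      using Cons.prems by (auto simp: fan_apex_def)
    have ra: "reduced_word (h @ [a])" and rb: "reduced_word (h @ [b])"
      using Cons.prems by (auto simp: distinct_adj_append_iff)
    have "d \<noteq> c" using Cons.prems by (auto simp: distinct_adj_append_iff)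
    then consider "d = a" | "d = b" using three_letters[OF Cons.prems(3-5)] by metis
    then show ?case
    proof cases
      case 1
      show ?thesis
        using branch_dichotomy[OF Cons.prems(1-7)]
      proof
        assume "subtree C (h @ [a])"
        then show ?thesis using Cons.prems(8) 1 by (auto simp: subtree_def prefix_def)
      next
        assume "subtree nX (h @ [b])"
        then have "nX (fan_word h b a 0)" using rb by (auto simp: subtree_def)
        then have "pivot nX (h @ [a]) a b" by (rule pivot_start[OF apex(1)])
        moreover have "pivot C (h @ [a]) a c" using Cons.prems(6) by (rule pivot_extend)
        ultimately have "C ((h @ [a]) @ z @ a' # u) \<or> nX ((h @ [a]) @ z @ b' # v)"
          using Cons.prems 1 ra orientation_snoc[OF Cons.prems(3-5), of h]
          by (intro Cons.IH[of _ a c b]) auto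
        then show ?thesis using 1 by simp
      qed
    next
      case 2
      show ?thesis
        using branch_dichotomy[OF Cons.prems(1-7)]
      proof
        assume "subtree nX (h @ [b])"
        then show ?thesis using Cons.prems(9) 2 by (auto simp: subtree_def prefix_def)
      next
        assume "subtree C (h @ [a])"
        then have "C (fan_word h a b 0)" using ra by (auto simp: subtree_def)
        then have "pivot C (h @ [b]) b a" by (rule pivot_start[OF apex(2)])
        moreover have "pivot nX (h @ [b]) b c" using Cons.prems(7) by (rule pivot_extend)
        ultimately have "C ((h @ [b]) @ z @ a' # u) \<or> nX ((h @ [b]) @ z @ b' # v)"
          using Cons.prems 2 rb orientation_snoc[OF Cons.prems(3-5), of h]
          by (intro Cons.IH[of _ b a c]) auto
        then show ?thesis using 2 by simp
      qed
    qed
  qed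
qed

end

section \<open>Pencils through a simple root\<close>

definition height :: "real ^ 3 \<Rightarrow> real" where
  "height x = x $ 1 + x $ 2 + x $ 3"

lemma height_simps:
  "height (x + y) = height x + height y" "height (c *\<^sub>R x) = c * height x"
  "height (x - y) = height x - height y" "height (simple_root k) = 1"
  using exhaust_3[of k] by (auto simp: height_def axis_def algebra_simps)

lemma height_root_pos: "reduced_word w \<Longrightarrow> 0 < height (root_of w)"
  using form_simple_root_hd[of w] root_nonneg[of w 1] root_nonneg[of w 2] root_nonneg[of w 3]
    exhaust_3[of "hd w"]
  unfolding form_simple_left height_def by auto

lemma height_gt_coord: "reduced_word w \<Longrightarrow> hd w \<noteq> k \<Longrightarrow> root_of w $ k < height (root_of w)"
  using form_simple_root_not_hd[of w k] root_nonneg[of w k]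
  unfolding form_simple_left height_def by auto

text \<open>Two roots in the same direction from \<open>\<alpha>\<^sub>k\<close> have proportional coordinates apart from the \<open>k\<close>-th.\<close>

lemma vol_zero_imp_same_line:
  assumes "reduced_word u" "hd u \<noteq> k" "reduced_word v" "hd v \<noteq> k"
    and "vol (root_of u) (root_of v) (simple_root k) = 0"
  shows "\<exists>s t. 0 < s \<and> root_of u = s *\<^sub>R root_of v + t *\<^sub>R simple_root k"
proof -
  define x y where xy: "x = root_of u" "y = root_of v"
  have pos: "0 < height x - x $ k" "0 < height y - y $ k"
    using height_gt_coord assms(1-4) by (simp_all add: xy)
  define s where "s = (height x - x $ k) / (height y - y $ k)"
  have "(height y - y $ k) * x $ i = (height x - x $ k) * y $ i" if "i \<noteq> k" for i
    using assms(5) that exhaust_3[of k] exhaust_3[of i]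
    by (auto simp: vol_def axis_def height_def xy algebra_simps)
  then have coord: "x $ i = s * y $ i" if "i \<noteq> k" for i
    using pos that by (simp add: s_def field_simps)
  have "x = s *\<^sub>R y + (x $ k - s * y $ k) *\<^sub>R simple_root k"
    using coord by (auto simp: vec_eq_iff axis_def)
  moreover have "0 < s" using pos by (simp add: s_def)
  ultimately show ?thesis unfolding xy by blast
qed

text \<open>The pencil of all lines through the simple root \<open>\<alpha>\<^sub>k\<close>. The classes \<open>P\<close> and \<open>Q\<close> are a coclosed set and
  the complement of its closure, in either order, and no word of \<open>Q\<close> starts with \<open>k\<close>. The properties
  needed are symmetric decompositions of nested pairs, with the new word in the class of the longer one, and
  one planar fact: no \<open>P\<close> between two \<open>Q\<close>.\<close>

locale pencil =
  fixes P Q :: "3 list \<Rightarrow> bool" and k :: 3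
  assumes P_reduced: "P p \<Longrightarrow> reduced_word p"
    and Q_reduced: "Q q \<Longrightarrow> reduced_word q"
    and Q_hd: "Q q \<Longrightarrow> hd q \<noteq> k"
    and Q_above: "P p \<Longrightarrow> Q q \<Longrightarrow> strict_prefix p q \<Longrightarrow>
      \<exists>q' s t. Q q' \<and> q' \<parallel> p \<and> 0 < s \<and> 0 < t \<and>
        root_of q = s *\<^sub>R root_of p + t *\<^sub>R root_of q' \<and> length q' < length q"
    and P_above: "P p \<Longrightarrow> Q q \<Longrightarrow> strict_prefix q p \<Longrightarrow>
      \<exists>p' s t. P p' \<and> p' \<parallel> q \<and> 0 < s \<and> 0 < t \<and>
        root_of p = s *\<^sub>R root_of q + t *\<^sub>R root_of p' \<and> length p' < length p"
    and not_between: "P p \<Longrightarrow> Q q \<Longrightarrow> 0 \<le> a \<Longrightarrow> 0 \<le> b \<Longrightarrow>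
      root_of q = a *\<^sub>R root_of p + b *\<^sub>R simple_root k \<Longrightarrow> False"
    and no_QPQ: "Q u \<Longrightarrow> P v \<Longrightarrow> Q w \<Longrightarrow> hd v \<noteq> k \<Longrightarrow> u \<parallel> v \<Longrightarrow> v \<parallel> w \<Longrightarrow>
      0 < vol (root_of u) (root_of v) (simple_root k) \<Longrightarrow>
      0 < vol (root_of v) (root_of w) (simple_root k) \<Longrightarrow> False"
begin

abbreviation K :: "real ^ 3" where
  "K \<equiv> simple_root k"

text \<open>In the projective plane, the segment from \<open>p\<close> to \<open>\<alpha>\<^sub>k\<close> crosses the segment from \<open>q1\<close> to \<open>q2\<close>.\<close>

definition crossing :: "3 list \<Rightarrow> 3 list \<Rightarrow> 3 list \<Rightarrow> bool" where
  "crossing p q1 q2 \<longleftrightarrow> P p \<and> Q q1 \<and> Q q2 \<and> (\<exists>a b c. 0 < a \<and> 0 < b \<and> 0 < c \<and>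
    a *\<^sub>R root_of p + K = b *\<^sub>R root_of q1 + c *\<^sub>R root_of q2)"

text \<open>In the projective plane, \<open>q\<close> is in the interior of the triangle with vertices \<open>p1\<close>, \<open>p2\<close> and \<open>\<alpha>\<^sub>k\<close>.\<close>

definition inside :: "3 list \<Rightarrow> 3 list \<Rightarrow> 3 list \<Rightarrow> bool" where
  "inside q p1 p2 \<longleftrightarrow> Q q \<and> P p1 \<and> P p2 \<and> (\<exists>a b c. 0 < a \<and> 0 < b \<and> 0 < c \<and>
    a *\<^sub>R root_of p1 + b *\<^sub>R root_of p2 + K = c *\<^sub>R root_of q)"

lemma crossingI:
  "P p \<Longrightarrow> Q q1 \<Longrightarrow> Q q2 \<Longrightarrow> 0 < a \<Longrightarrow> 0 < b \<Longrightarrow> 0 < c \<Longrightarrow>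
    a *\<^sub>R root_of p + K = b *\<^sub>R root_of q1 + c *\<^sub>R root_of q2 \<Longrightarrow> crossing p q1 q2"
  unfolding crossing_def by blast

lemma insideI:
  "Q q \<Longrightarrow> P p1 \<Longrightarrow> P p2 \<Longrightarrow> 0 < a \<Longrightarrow> 0 < b \<Longrightarrow> 0 < c \<Longrightarrow>
    a *\<^sub>R root_of p1 + b *\<^sub>R root_of p2 + K = c *\<^sub>R root_of q \<Longrightarrow> inside q p1 p2"
  unfolding inside_def by blast

lemma crossing_commute: "crossing p q1 q2 \<Longrightarrow> crossing p q2 q1"
  unfolding crossing_def by (metis add.commute)

lemma inside_commute: "inside q p1 p2 \<Longrightarrow> inside q p2 p1"
  unfolding inside_def by (metis add.commute)

lemma P_neq_Q: "P p \<Longrightarrow> Q q \<Longrightarrow> p \<noteq> q"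
  using not_between[of p q 1 0] by auto

lemma not_on_segment:
  assumes "P p" "Q q" "0 < c" "0 \<le> a" "0 \<le> b" "a *\<^sub>R root_of p + b *\<^sub>R K = c *\<^sub>R root_of q"
  shows False
proof -
  have "root_of q = (1 / c) *\<^sub>R (c *\<^sub>R root_of q)" using assms(3) by simp
  also have "\<dots> = (a / c) *\<^sub>R root_of p + (b / c) *\<^sub>R K"
    unfolding assms(6)[symmetric] by (simp add: scaleR_add_right)
  finally show False using not_between[of p q "a / c" "b / c"] assms by simp
qed

lemma form_K_Q: "Q q \<Longrightarrow> form K (root_of q) \<le> - 1"
  using form_simple_root_not_hd[OF Q_reduced, of q k] Q_hd[of q] by auto

lemma form_parallel: "P p \<Longrightarrow> Q q \<Longrightarrow> p \<parallel> q \<Longrightarrow> form (root_of p) (root_of q) \<le> - 1"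
  using form_root_parallel[OF P_reduced Q_reduced] by blast

lemma form_pos_comparable:
  assumes "P p" "Q q" "0 < form (root_of p) (root_of q)"
  shows "strict_prefix p q \<or> strict_prefix q p"
  using form_root_pos_imp_comparable[OF P_reduced[OF assms(1)] Q_reduced[OF assms(2)] assms(3)]
    P_neq_Q[OF assms(1,2)] by (auto simp: strict_prefix_def)

lemma crossing_hd: "crossing p q1 q2 \<Longrightarrow> hd p \<noteq> k"
proof
  assume "crossing p q1 q2" and hd: "hd p = k"
  then obtain a b c where *: "P p" "Q q1" "Q q2" "0 < a" "0 < b" "0 < c"
    "a *\<^sub>R root_of p + K = b *\<^sub>R root_of q1 + c *\<^sub>R root_of q2"
    unfolding crossing_def by blast
  have "a * form K (root_of p) + 1 = b * form K (root_of q1) + c * form K (root_of q2)"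
    using arg_cong[OF *(7), of "form K"] by (simp add: form_simps form_simple_root)
  moreover have "1 \<le> form K (root_of p)"
    using form_simple_root_hd[OF P_reduced[OF *(1)]] hd by simp
  moreover have "b * form K (root_of q1) < 0" "c * form K (root_of q2) < 0"
    using form_K_Q[OF *(2)] form_K_Q[OF *(3)] *(5,6) by (simp_all add: mult_pos_neg)
  ultimately show False using *(4) by (smt (verit) mult_pos_pos)
qed

text \<open>Pairing with the root of \<open>q\<close> shows that \<open>q\<close> is comparable to \<open>p1\<close> or \<open>p2\<close>. Decomposing the longer of
  the two words gives a configuration of the same kind with a shorter word, except when \<open>p1\<close> is
  a prefix of \<open>q\<close> and the new word \<open>q'\<close> is so far away that the segment from \<open>q\<close> to \<open>q'\<close> passes between
  \<open>p2\<close> and \<open>\<alpha>\<^sub>k\<close>.\<close>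

lemma inside_imp_crossing: "inside q p1 p2 \<Longrightarrow> \<exists>p q1 q2. crossing p q1 q2"
proof (induction "length q + length p1 + length p2" arbitrary: q p1 p2 rule: less_induct)
  case less
  have main: "\<exists>p q1 q2. crossing p q1 q2"
    if ins: "inside q p1 p2" and pos: "0 < form (root_of p1) (root_of q)"
      and IH: "\<And>q' p1' p2'. length q' + length p1' + length p2' < length q + length p1 + length p2 \<Longrightarrow>
        inside q' p1' p2' \<Longrightarrow> \<exists>p q1 q2. crossing p q1 q2" for q p1 p2
  proof -
    obtain a b c where *: "Q q" "P p1" "P p2" "0 < a" "0 < b" "0 < c"
      and eq: "a *\<^sub>R root_of p1 + b *\<^sub>R root_of p2 + K = c *\<^sub>R root_of q"
      using ins unfolding inside_def by blast
    consider "strict_prefix q p1" | "strict_prefix p1 q"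
      using form_pos_comparable[OF *(2,1) pos] by blast
    then show ?thesis
    proof cases
      case 1
      then obtain p' s t where p': "P p'" "0 < s" "0 < t" "length p' < length p1"
        "root_of p1 = s *\<^sub>R root_of q + t *\<^sub>R root_of p'"
        using P_above[OF *(2,1)] by blast
      have eq': "(a * t) *\<^sub>R root_of p' + b *\<^sub>R root_of p2 + K = (c - a * s) *\<^sub>R root_of q"
        using eq unfolding p'(5) by (simp add: algebra_simps)
      have "a * t * height (root_of p') + b * height (root_of p2) + 1 = (c - a * s) * height (root_of q)"
        using arg_cong[OF eq', of height] by (simp add: height_simps)
      moreover have "0 < a * t * height (root_of p')" "0 < b * height (root_of p2)"
        using *(4,5) p'(3) height_root_pos P_reduced *(3) p'(1) by simp_all
      ultimately have "0 < (c - a * s) * height (root_of q)" by linarith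
      then have "0 < c - a * s"
        using height_root_pos[OF Q_reduced[OF *(1)]] by (simp add: zero_less_mult_iff)
      then have "inside q p' p2"
        using insideI[OF *(1) p'(1) *(3) _ _ _ eq'] *(4,5) p'(3) by simp
      then show ?thesis using IH[of q p' p2] p'(4) by simp
    next
      case 2
      then obtain q' s t where q': "Q q'" "0 < s" "0 < t" "length q' < length q"
        "root_of q = s *\<^sub>R root_of p1 + t *\<^sub>R root_of q'"
        using Q_above[OF *(2,1)] by blast
      have eq': "(a - c * s) *\<^sub>R root_of p1 + b *\<^sub>R root_of p2 + K = (c * t) *\<^sub>R root_of q'"
        using eq unfolding q'(5) by (simp add: algebra_simps)
      have ct: "0 < c * t" using *(6) q'(3) by simp
      consider "c * s < a" | "c * s = a" | "a < c * s" by linarith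
      then show ?thesis
      proof cases
        case 1
        then have "inside q' p1 p2"
          using insideI[OF q'(1) *(2,3) _ *(5) ct eq'] by simp
        then show ?thesis using IH[of q' p1 p2] q'(4) by simp
      next
        case 2
        then show ?thesis using not_on_segment[OF *(3) q'(1) ct, of b 1] eq' *(5) by simp
      next
        case 3
        have p1: "root_of p1 = (1 / s) *\<^sub>R root_of q - (t / s) *\<^sub>R root_of q'"
          using q'(2) unfolding q'(5) by (simp add: algebra_simps)
        have "b *\<^sub>R root_of p2 + K = c *\<^sub>R root_of q - a *\<^sub>R root_of p1"
          unfolding eq[symmetric] by simp
        also have "\<dots> = (c - a / s) *\<^sub>R root_of q + (a * t / s) *\<^sub>R root_of q'"
          unfolding p1 by (simp add: algebra_simps)
        finally have "b *\<^sub>R root_of p2 + K = (c - a / s) *\<^sub>R root_of q + (a * t / s) *\<^sub>R root_of q'" .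
        moreover have "0 < c - a / s" "0 < a * t / s"
          using 3 *(4) q'(2,3) by (simp_all add: field_simps)
        ultimately have "crossing p2 q q'"
          using crossingI[OF *(3,1) q'(1) *(5)] by blast
        then show ?thesis by blast
      qed
    qed
  qed
  obtain a b c where *: "Q q" "P p1" "P p2" "0 < a" "0 < b" "0 < c"
    and eq: "a *\<^sub>R root_of p1 + b *\<^sub>R root_of p2 + K = c *\<^sub>R root_of q"
    using less.prems unfolding inside_def by blast
  have "a * form (root_of p1) (root_of q) + b * form (root_of p2) (root_of q) + form K (root_of q) = c"
    using arg_cong[OF eq, of "\<lambda>x. form x (root_of q)"] form_root_self[of q] Q_reduced[OF *(1)]
    by (simp add: form_simps)
  then have "0 < a * form (root_of p1) (root_of q) + b * form (root_of p2) (root_of q)"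
    using form_K_Q[OF *(1)] *(6) by linarith
  then have "0 < form (root_of p1) (root_of q) \<or> 0 < form (root_of p2) (root_of q)"
    using *(4,5) by (smt (verit) mult_nonneg_nonpos)
  then show ?case
  proof
    assume "0 < form (root_of p1) (root_of q)"
    then show ?thesis by (rule main[OF less.prems]) (rule less.hyps)
  next
    assume "0 < form (root_of p2) (root_of q)"
    then show ?thesis
    proof (rule main[OF inside_commute[OF less.prems]])
      fix q' p1' p2'
      assume "length q' + length p1' + length p2' < length q + length p2 + length p1" "inside q' p1' p2'"
      then show "\<exists>p q1 q2. crossing p q1 q2" by (intro less.hyps) simp_all
    qed
  qed
qed

text \<open>If the configuration were contained in a line through \<open>\<alpha>\<^sub>k\<close>, then \<open>q1\<close> and \<open>q2\<close> would both be beyond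
  \<open>p\<close> as seen from \<open>\<alpha>\<^sub>k\<close>, and no segment between them could meet the segment from \<open>p\<close> to \<open>\<alpha>\<^sub>k\<close>.\<close>

lemma crossing_vol_nonzero:
  assumes "crossing p q1 q2"
  shows "vol (root_of q1) (root_of p) K \<noteq> 0"
proof
  assume V: "vol (root_of q1) (root_of p) K = 0"
  obtain a b c where *: "P p" "Q q1" "Q q2" "0 < a" "0 < b" "0 < c"
    and eq: "a *\<^sub>R root_of p + K = b *\<^sub>R root_of q1 + c *\<^sub>R root_of q2"
    using assms unfolding crossing_def by blast
  have hd: "hd p \<noteq> k" by (rule crossing_hd[OF assms])
  have "vol (a *\<^sub>R root_of p + K) (root_of p) K = vol (b *\<^sub>R root_of q1 + c *\<^sub>R root_of q2) (root_of p) K"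
    using eq by simp
  then have V2: "vol (root_of q2) (root_of p) K = 0"
    using V *(6) by (simp add: vol_simps)
  have line: "\<exists>s t. t < 0 \<and> root_of q = s *\<^sub>R root_of p + t *\<^sub>R K"
    if q: "Q q" "vol (root_of q) (root_of p) K = 0" for q
  proof -
    obtain s t where st: "0 < s" "root_of q = s *\<^sub>R root_of p + t *\<^sub>R K"
      using vol_zero_imp_same_line[OF Q_reduced[OF q(1)] Q_hd[OF q(1)] P_reduced[OF *(1)] hd q(2)] by blast
    then have "t < 0" using not_between[OF *(1) q(1), of s t] by force
    then show ?thesis using st by blast
  qed
  obtain s t s' t' where q1: "t < 0" "root_of q1 = s *\<^sub>R root_of p + t *\<^sub>R K"
    and q2: "t' < 0" "root_of q2 = s' *\<^sub>R root_of p + t' *\<^sub>R K"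
    using line[OF *(2) V] line[OF *(3) V2] by blast
  have eq': "(a - b * s - c * s') *\<^sub>R root_of p = (b * t + c * t' - 1) *\<^sub>R K"
    using eq unfolding q1(2) q2(2) by (simp add: algebra_simps)
  have "(a - b * s - c * s') * (height (root_of p) - root_of p $ k) = 0"
    using arg_cong[OF eq', of "\<lambda>x. height x - x $ k"]
    by (simp add: height_simps right_diff_distrib)
  then have "a - b * s - c * s' = 0"
    using height_gt_coord[OF P_reduced[OF *(1)] hd] by simp
  then have "b * t + c * t' - 1 = 0"
    using eq' by (auto simp: axis_eq_0_iff)
  moreover have "b * t < 0" "c * t' < 0" using *(5,6) q1(1) q2(1) by (simp_all add: mult_pos_neg)
  ultimately show False by linarith
qed

lemma crossing_vol_sign:
  assumes "crossing p q1 q2"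
  shows "0 < vol (root_of q1) (root_of p) K \<longleftrightarrow> 0 < vol (root_of p) (root_of q2) K"
proof -
  obtain a b c where *: "0 < a" "0 < b" "0 < c"
    and eq: "a *\<^sub>R root_of p + K = b *\<^sub>R root_of q1 + c *\<^sub>R root_of q2"
    using assms unfolding crossing_def by blast
  have "vol (a *\<^sub>R root_of p + K) (root_of p) K = vol (b *\<^sub>R root_of q1 + c *\<^sub>R root_of q2) (root_of p) K"
    using eq by simp
  then have "b * vol (root_of q1) (root_of p) K = c * vol (root_of p) (root_of q2) K"
    using vol_swap[of "root_of p" "root_of q2"] by (simp add: vol_simps)
  then show ?thesis using *(2,3) by (metis zero_less_mult_pos mult_pos_pos)
qed

text \<open>As seen from \<open>\<alpha>\<^sub>k\<close>, the word \<open>p\<close> would be strictly between the two parallel words \<open>q1\<close> and \<open>q2\<close>.\<close>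

lemma crossing_not_both_parallel:
  assumes "crossing p q1 q2" "q1 \<parallel> p" "q2 \<parallel> p"
  shows False
proof -
  have Q: "Q q1" "P p" "Q q2" using assms(1) by (auto simp: crossing_def)
  have hd: "hd p \<noteq> k" by (rule crossing_hd[OF assms(1)])
  show False
  proof (cases "0 < vol (root_of q1) (root_of p) K")
    case True
    then show False
      using no_QPQ[OF Q hd assms(2)] assms(3) crossing_vol_sign[OF assms(1)] parallel_commute by blast
  next
    case False
    then have "0 < vol (root_of p) (root_of q1) K"
      using crossing_vol_nonzero[OF assms(1)] vol_swap[of "root_of p" "root_of q1"] by auto
    then show False
      using no_QPQ[OF Q(3,2,1) hd assms(3)] assms(2) crossing_vol_sign[OF crossing_commute[OF assms(1)]]
        parallel_commute by blast
  qed
qed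

lemma crossing_lower:
  assumes "crossing p q1 q2" "strict_prefix p q1"
  shows "\<exists>q'. crossing p q' q2 \<and> q' \<parallel> p \<and> length q' < length q1"
proof -
  obtain a b c where *: "P p" "Q q1" "Q q2" "0 < a" "0 < b" "0 < c"
    and eq: "a *\<^sub>R root_of p + K = b *\<^sub>R root_of q1 + c *\<^sub>R root_of q2"
    using assms unfolding crossing_def by blast
  obtain q' s t where q': "Q q'" "q' \<parallel> p" "0 < s" "0 < t" "length q' < length q1"
    "root_of q1 = s *\<^sub>R root_of p + t *\<^sub>R root_of q'"
    using Q_above[OF *(1,2) assms(2)] by blast
  have eq': "(a - b * s) *\<^sub>R root_of p + K = (b * t) *\<^sub>R root_of q' + c *\<^sub>R root_of q2"
    using eq unfolding q'(6) by (simp add: algebra_simps)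
  have "(a - b * s) * form K (root_of p) + 1 = b * t * form K (root_of q') + c * form K (root_of q2)"
    using arg_cong[OF eq', of "form K"] by (simp add: form_simps form_simple_root)
  moreover have "b * t * form K (root_of q') < 0" "c * form K (root_of q2) < 0"
    using form_K_Q[OF q'(1)] form_K_Q[OF *(3)] *(5,6) q'(4) by (auto intro!: mult_pos_neg)
  ultimately have "(a - b * s) * form K (root_of p) < 0" by linarith
  moreover have "form K (root_of p) < 0"
    using form_simple_root_not_hd[OF P_reduced[OF *(1)], of k] crossing_hd[OF assms(1)] by auto
  ultimately have "0 < a - b * s" by (simp add: mult_less_0_iff)
  then have "crossing p q' q2"
    using crossingI[OF *(1) q'(1) *(3) _ _ *(6) eq'] *(5) q'(4) by simp
  then show ?thesis using q' by blast
qed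

lemma crossing_normalize:
  assumes "crossing p q1 q2"
  shows "\<exists>q1 q2. crossing p q1 q2 \<and> strict_prefix q1 p"
proof -
  have cases: "strict_prefix q p \<or> q \<parallel> p \<or> strict_prefix p q" if "Q q" "P p" for p q
    using P_neq_Q[OF that(2,1)] by (auto simp: strict_prefix_def parallel_def)
  have "\<exists>q1. crossing p q1 q2 \<and> (strict_prefix q1 p \<or> q1 \<parallel> p)" if c: "crossing p q1 q2" for q1 q2
    using crossing_lower[OF c] cases[of q1 p] c unfolding crossing_def by blast
  then obtain r1 where r1: "crossing p r1 q2" "strict_prefix r1 p \<or> r1 \<parallel> p"
    using assms by blast
  then have "crossing p q2 r1" by (simp add: crossing_commute)
  then obtain r2 where r2: "crossing p r2 r1" "strict_prefix r2 p \<or> r2 \<parallel> p"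
    using \<open>\<And>q2 q1. crossing p q1 q2 \<Longrightarrow> \<exists>q1. crossing p q1 q2 \<and> (strict_prefix q1 p \<or> q1 \<parallel> p)\<close> by blast
  then show ?thesis
    using crossing_not_both_parallel[OF r2(1)] r1(2) crossing_commute by blast
qed

text \<open>Decompose \<open>p\<close> along its prefix \<open>q1\<close>. If the new word \<open>p'\<close> were not beyond \<open>q2\<close> in the order seen from
  \<open>\<alpha>\<^sub>k\<close>, it would give a crossing with the shorter word \<open>p'\<close>. So \<open>q2\<close> is inside the triangle with
  vertices \<open>p\<close>, \<open>p'\<close> and \<open>\<alpha>\<^sub>k\<close>.\<close>

lemma minimal_crossing_inside:
  assumes "crossing p q1 q2" "strict_prefix q1 p"
    and min: "\<And>p' q q'. length p' < length p \<Longrightarrow> \<not> crossing p' q q'"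
  shows "\<exists>p' u v a b c. P p' \<and> p' \<parallel> q1 \<and> length p' < length p \<and> 0 < u \<and> 0 < v \<and> 0 < a \<and> 0 < b \<and> 0 < c \<and>
    root_of p = u *\<^sub>R root_of q1 + v *\<^sub>R root_of p' \<and>
    a *\<^sub>R root_of p + b *\<^sub>R root_of p' + K = c *\<^sub>R root_of q2"
proof -
  obtain a b c where *: "P p" "Q q1" "Q q2" "0 < a" "0 < b" "0 < c"
    and eq: "a *\<^sub>R root_of p + K = b *\<^sub>R root_of q1 + c *\<^sub>R root_of q2"
    using assms unfolding crossing_def by blast
  obtain p' u v where p': "P p'" "p' \<parallel> q1" "0 < u" "0 < v" "length p' < length p"
    "root_of p = u *\<^sub>R root_of q1 + v *\<^sub>R root_of p'"
    using P_above[OF *(1,2) assms(2)] by blast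
  have eq': "(a * v) *\<^sub>R root_of p' + K = (b - a * u) *\<^sub>R root_of q1 + c *\<^sub>R root_of q2"
    using eq unfolding p'(6) by (simp add: algebra_simps)
  have av: "0 < a * v" using *(4) p'(4) by simp
  have "\<not> a * u < b"
    using crossingI[OF p'(1) *(2,3) av _ *(6) eq'] min[OF p'(5)] by auto
  moreover have "a * u \<noteq> b"
    using not_on_segment[OF p'(1) *(3,6), of "a * v" 1] eq' av by auto
  ultimately have "b < a * u" by linarith
  then have pos: "0 < a - b / u" "0 < b * v / u"
    using *(5) p'(3,4) by (simp_all add: field_simps)
  have q1: "root_of q1 = (1 / u) *\<^sub>R root_of p - (v / u) *\<^sub>R root_of p'"
    using p'(3) unfolding p'(6) by (simp add: algebra_simps)
  have "c *\<^sub>R root_of q2 = a *\<^sub>R root_of p + K - b *\<^sub>R root_of q1"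
    using eq by simp
  also have "\<dots> = (a - b / u) *\<^sub>R root_of p + (b * v / u) *\<^sub>R root_of p' + K"
    unfolding q1 by (simp add: algebra_simps)
  finally have "(a - b / u) *\<^sub>R root_of p + (b * v / u) *\<^sub>R root_of p' + K = c *\<^sub>R root_of q2" by simp
  then show ?thesis using p' pos *(6) by blast
qed

end

context pencil
begin

text \<open>The root of \<open>q\<close> is on the same side of the line through \<open>q1\<close> and \<open>p\<close> as \<open>\<alpha>\<^sub>k\<close>. The quotients are the
  slopes at \<open>p\<close> of the lines from \<open>p\<close> to \<open>q1\<close> and to \<open>q\<close>: the functional \<open>l\<close> vanishes at \<open>p\<close> and is
  positive at \<open>\<alpha>\<^sub>k\<close>, the determinant vanishes at both.\<close>

lemma crossing_slope:
  assumes "0 < e * vol (root_of q1) (root_of p) K" "0 < e * vol (root_of q) (root_of p) K"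
    and "root_of p = u *\<^sub>R root_of q1 + v *\<^sub>R x" "v \<noteq> 0"
    and "a *\<^sub>R root_of p + b *\<^sub>R x + K = c *\<^sub>R root_of q" "0 < c"
    and "root_of p $ k < height (root_of p)"
  defines "l \<equiv> \<lambda>y. y $ k * (height (root_of p) - root_of p $ k) - root_of p $ k * (height y - y $ k)"
  shows "l (root_of q1) / (e * vol (root_of q1) (root_of p) K) < l (root_of q) / (e * vol (root_of q) (root_of p) K)"
proof -
  define d where "d y = e * vol y (root_of p) K" for y
  define f where "f y = l y * d (root_of q1) - l (root_of q1) * d y" for y
  have f_add: "f (y + z) = f y + f z" and f_scale: "f (t *\<^sub>R y) = t * f y" for y z t
    by (simp_all add: f_def l_def d_def height_simps vol_simps algebra_simps)
  have "f (root_of q1) = 0" by (simp add: f_def)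
  moreover have fp: "f (root_of p) = 0"
    by (simp add: f_def l_def d_def vol_simps)
  ultimately have "f x = 0"
    using arg_cong[OF assms(3), of f] assms(4) by (simp add: f_add f_scale)
  moreover have "0 < f K"
    using assms(1,7) by (simp add: f_def l_def d_def vol_simps height_simps)
  ultimately have "0 < c * f (root_of q)"
    using arg_cong[OF assms(5), of f] fp by (simp add: f_add f_scale)
  then have "0 < f (root_of q)" using assms(6) by (simp add: zero_less_mult_iff)
  then show ?thesis
    using assms(1,2) by (simp add: f_def d_def[symmetric] frac_less_eq field_simps)
qed

text \<open>Choose \<open>p\<close> as short as possible, then \<open>q1\<close> among the prefixes of \<open>p\<close> on one side such that the line
  from \<open>p\<close> to \<open>q1\<close> is turned as far as possible towards \<open>\<alpha>\<^sub>k\<close>, then \<open>q2\<close> as short as possible. With \<open>p'\<close> at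
  the far end of the line from \<open>q1\<close> through \<open>p\<close>, the root of \<open>q2\<close> is inside the triangle \<open>p\<close>, \<open>p'\<close>,
  \<open>\<alpha>\<^sub>k\<close>. If \<open>q2\<close> is a prefix of \<open>p\<close>, the same holds with \<open>q1\<close> and \<open>q2\<close> exchanged, and the resulting
  comparabilities between words contradict each other. Otherwise \<open>p'\<close> is a prefix of \<open>q2\<close>, and
  decomposing \<open>q2\<close> along \<open>p'\<close> yields a crossing that violates one of the three choices or has
  both words parallel to \<open>p\<close>.\<close>

lemma no_crossing: "\<not> crossing p q1 q2"
proof
  assume "crossing p q1 q2"
  then have "\<exists>p. \<exists>q1 q2. crossing p q1 q2" by blast
  then obtain p where exp: "\<exists>q1 q2. crossing p q1 q2"
    and "\<And>p'. (\<exists>q1 q2. crossing p' q1 q2) \<Longrightarrow> length p \<le> length p'"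
    using ex_has_least_nat[of "\<lambda>p. \<exists>q1 q2. crossing p q1 q2" _ length] by blast
  then have min: "\<not> crossing p' q q'" if "length p' < length p" for p' q q'
    using that by (meson leD)
  obtain q0 q0' where start: "crossing p q0 q0'" "strict_prefix q0 p"
    using exp crossing_normalize by blast
  have P: "P p" and rp: "reduced_word p" using start P_reduced by (auto simp: crossing_def)
  have hp: "root_of p $ k < height (root_of p)"
    using height_gt_coord[OF rp crossing_hd[OF start(1)]] .
  \<comment> \<open>The sign \<open>e\<close> makes both possible orders of \<open>q1\<close>, \<open>p\<close>, \<open>q2\<close> look the same.\<close>
  define e :: real where "e = (if 0 < vol (root_of q0) (root_of p) K then 1 else - 1)"
  have e: "0 < e * vol (root_of q0) (root_of p) K"
    using crossing_vol_nonzero[OF start(1)] by (auto simp: e_def)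
  have e_sign: "0 < e * vol (root_of r) (root_of p) K \<longleftrightarrow> 0 < e * vol (root_of p) (root_of r') K"
    if "crossing p r r'" for r r'
  proof -
    have "vol (root_of r') (root_of p) K \<noteq> 0"
      using crossing_vol_nonzero[OF crossing_commute[OF that]] .
    then show ?thesis
      using crossing_vol_sign[OF that] crossing_vol_nonzero[OF that] vol_swap[of "root_of p" "root_of r'"]
      by (auto simp: e_def)
  qed
  define Z where "Z = {q. strict_prefix q p \<and> 0 < e * vol (root_of q) (root_of p) K \<and> (\<exists>q'. crossing p q q')}"
  define slope where "slope q = (root_of q $ k * (height (root_of p) - root_of p $ k)
      - root_of p $ k * (height (root_of q) - root_of q $ k)) / (e * vol (root_of q) (root_of p) K)" for q
  have "Z \<subseteq> set (prefixes p)" by (auto simp: Z_def strict_prefix_def)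
  then have fin: "finite Z" by (rule finite_subset) simp
  have ne: "Z \<noteq> {}" using start e by (auto simp: Z_def)
  obtain q1 where q1: "q1 \<in> Z" and max: "\<And>q. q \<in> Z \<Longrightarrow> slope q \<le> slope q1"
    using finite_imageI[OF fin, of slope] ne Max_in[of "slope ` Z"] Max_ge[of "slope ` Z"]
    by (metis (no_types, lifting) image_iff image_is_empty imageI)
  have pre1: "strict_prefix q1 p" and e1: "0 < e * vol (root_of q1) (root_of p) K"
    and "\<exists>q'. crossing p q1 q'"
    using q1 by (auto simp: Z_def)
  then obtain q2 where c12: "crossing p q1 q2"
    and min2: "\<And>q'. crossing p q1 q' \<Longrightarrow> length q2 \<le> length q'"
    using ex_has_least_nat[of "\<lambda>q'. crossing p q1 q'" _ length] by blast
  have Q1: "Q q1" and Q2: "Q q2" using c12 by (auto simp: crossing_def)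
  obtain p' u v a b c where p': "P p'" "p' \<parallel> q1" "length p' < length p" "0 < u" "0 < v" "0 < a" "0 < b" "0 < c"
    and rp': "root_of p = u *\<^sub>R root_of q1 + v *\<^sub>R root_of p'"
    and eq: "a *\<^sub>R root_of p + b *\<^sub>R root_of p' + K = c *\<^sub>R root_of q2"
    using minimal_crossing_inside[OF c12 pre1 min] by blast
  have pos_coeff: "0 < t" if "s *\<^sub>R root_of x + s' *\<^sub>R root_of y + K = t *\<^sub>R root_of q"
    "0 < s" "0 < s'" "P x" "P y" "Q q" for s s' t x y q
  proof -
    have "s * height (root_of x) + s' * height (root_of y) + 1 = t * height (root_of q)"
      using arg_cong[OF that(1), of height] by (simp add: height_simps)
    moreover have "0 < s * height (root_of x)" "0 < s' * height (root_of y)"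
      using that(2-5) height_root_pos P_reduced by simp_all
    ultimately have "0 < t * height (root_of q)" by linarith
    then show ?thesis
      using height_root_pos[OF Q_reduced[OF that(6)]] by (simp add: zero_less_mult_iff)
  qed
  have form_sum: "s * form (root_of x) (root_of q) + s' * form (root_of y) (root_of q) > 0"
    if "s *\<^sub>R root_of x + s' *\<^sub>R root_of y + K = t *\<^sub>R root_of q" "0 < t" "Q q" for s s' t x y q
    using arg_cong[OF that(1), of "\<lambda>z. form z (root_of q)"] form_root_self[of q] Q_reduced[OF that(3)]
      form_K_Q[OF that(3)] that(2) by (simp add: form_simps)
  have comparable: "strict_prefix y q \<or> strict_prefix q y"
    if "s *\<^sub>R root_of x + s' *\<^sub>R root_of y + K = t *\<^sub>R root_of q" "0 < s" "0 < s'"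
      "P x" "P y" "Q q" "x \<parallel> q" for s s' t x y q
  proof -
    have "0 < s * form (root_of x) (root_of q) + s' * form (root_of y) (root_of q)"
      using form_sum[OF that(1) pos_coeff[OF that(1-6)] that(6)] .
    moreover have "s * form (root_of x) (root_of q) < 0"
      using form_parallel[OF that(4,6,7)] that(2) by (intro mult_pos_neg) auto
    ultimately have "0 < s' * form (root_of y) (root_of q)" by linarith
    then have "0 < form (root_of y) (root_of q)" using that(3) by (simp add: zero_less_mult_iff)
    then show ?thesis using form_pos_comparable[OF that(5,6)] by blast
  qed
  have "\<not> strict_prefix p q2"
  proof
    assume "strict_prefix p q2"
    from crossing_lower[OF crossing_commute[OF c12] this] obtain q' where
      "crossing p q' q1" "length q' < length q2" by blast
    then show False using min2[of q'] crossing_commute by (meson leD)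
  qed
  then consider "strict_prefix q2 p" | "p \<parallel> q2"
    using P_neq_Q[OF P Q2] by (auto simp: strict_prefix_def parallel_def)
  then show False
  proof cases
    case 1
    obtain p'' u2 v2 a2 b2 c2 where p'': "P p''" "p'' \<parallel> q2" "0 < u2" "0 < v2" "0 < a2" "0 < b2"
      and rp'': "root_of p = u2 *\<^sub>R root_of q2 + v2 *\<^sub>R root_of p''"
      and eq2: "a2 *\<^sub>R root_of p + b2 *\<^sub>R root_of p'' + K = c2 *\<^sub>R root_of q1"
      using minimal_crossing_inside[OF crossing_commute[OF c12] 1 min] by blast
    have "(a * v2) *\<^sub>R root_of p'' + b *\<^sub>R root_of p' + K = (c - a * u2) *\<^sub>R root_of q2"
      using eq unfolding rp'' by (simp add: algebra_simps)
    then have comp2: "strict_prefix p' q2 \<or> strict_prefix q2 p'"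
      by (rule comparable) (use p' p'' Q2 in auto)
    have "(a2 * v) *\<^sub>R root_of p' + b2 *\<^sub>R root_of p'' + K = (c2 - a2 * u) *\<^sub>R root_of q1"
      using eq2 unfolding rp' by (simp add: algebra_simps)
    then have comp1: "strict_prefix p'' q1 \<or> strict_prefix q1 p''"
      by (rule comparable) (use p' p'' Q1 in auto)
    have contra: False if "prefix r r'" "x \<parallel> r" "strict_prefix x r' \<or> strict_prefix r' x" for r r' x :: "3 list"
      using that by (auto simp: parallel_def strict_prefix_def dest: prefix_order.trans prefix_same_cases)
    have "prefix q1 q2 \<or> prefix q2 q1"
      using pre1 1 by (auto simp: strict_prefix_def dest: prefix_same_cases)
    then show False using contra[OF _ p'(2) comp2] contra[OF _ p''(2) comp1] by blast
  next
    case par: 2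
    consider "strict_prefix p' q2" | "strict_prefix q2 p'"
      using comparable[OF eq p'(6,7) P p'(1) Q2 par] by blast
    then show False
    proof cases
      case 2
      obtain p3 s t where p3: "P p3" "p3 \<parallel> q2" "0 < s" "0 < t"
        "root_of p' = s *\<^sub>R root_of q2 + t *\<^sub>R root_of p3"
        using P_above[OF p'(1) Q2 2] by blast
      have eq3: "a *\<^sub>R root_of p + (b * t) *\<^sub>R root_of p3 + K = (c - b * s) *\<^sub>R root_of q2"
        using eq unfolding p3(5) by (simp add: algebra_simps)
      have "strict_prefix p3 q2 \<or> strict_prefix q2 p3"
        using comparable[OF eq3 p'(6) _ P p3(1) Q2 par] p'(7) p3(4) by simp
      then show False using p3(2) by (auto simp: parallel_def strict_prefix_def)
    next
      case 1
      obtain q' s t where q': "Q q'" "q' \<parallel> p'" "0 < s" "0 < t" "length q' < length q2"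
        "root_of q2 = s *\<^sub>R root_of p' + t *\<^sub>R root_of q'"
        using Q_above[OF p'(1) Q2 1] by blast
      have eq3: "a *\<^sub>R root_of p + (b - c * s) *\<^sub>R root_of p' + K = (c * t) *\<^sub>R root_of q'"
        using eq unfolding q'(6) by (simp add: algebra_simps)
      have ct: "0 < c * t" using p'(8) q'(4) by simp
      consider "c * s < b" | "c * s = b" | "b < c * s" by linarith
      then show False
      proof cases
        case 1
        have p'_eq: "root_of p' = (1 / v) *\<^sub>R root_of p - (u / v) *\<^sub>R root_of q1"
          using p'(5) unfolding rp' by (simp add: algebra_simps)
        define d where "d = b - c * s"
        have d: "0 < d" using 1 by (simp add: d_def)
        have "(a + d / v) *\<^sub>R root_of p + K = (d * u / v) *\<^sub>R root_of q1 + (c * t) *\<^sub>R root_of q'"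
          unfolding eq3[symmetric] d_def[symmetric] p'_eq by (simp add: algebra_simps)
        then have "crossing p q1 q'"
          using d p' by (intro crossingI[OF P Q1 q'(1) _ _ ct, of "a + d / v" "d * u / v"])
            (simp_all add: add_pos_pos)
        then show False using min2 q'(5) by (meson leD)
      next
        case 2
        then show False using not_on_segment[OF P q'(1) ct, of a 1] eq3 p'(6) by simp
      next
        case 3
        have p'_eq: "root_of p' = (1 / s) *\<^sub>R root_of q2 - (t / s) *\<^sub>R root_of q'"
          using q'(3) unfolding q'(6) by (simp add: algebra_simps)
        have "a *\<^sub>R root_of p + K = c *\<^sub>R root_of q2 - b *\<^sub>R root_of p'"
          unfolding eq[symmetric] by simp
        also have "\<dots> = (b * t / s) *\<^sub>R root_of q' + (c - b / s) *\<^sub>R root_of q2"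
          unfolding p'_eq by (simp add: algebra_simps)
        finally have c3: "crossing p q' q2"
          using 3 p' q' by (intro crossingI[OF P q'(1) Q2 p'(6), of "b * t / s" "c - b / s"])
            (simp_all add: field_simps)
        have "\<not> q' \<parallel> p"
          using crossing_not_both_parallel[OF c3] par parallel_commute by blast
        moreover have "\<not> strict_prefix p q'"
        proof
          assume "strict_prefix p q'"
          from crossing_lower[OF c3 this] obtain r where "crossing p r q2" "r \<parallel> p" by blast
          then show False using crossing_not_both_parallel par parallel_commute by blast
        qed
        ultimately have pre: "strict_prefix q' p"
          using P_neq_Q[OF P q'(1)] by (auto simp: strict_prefix_def parallel_def)
        have e': "0 < e * vol (root_of q') (root_of p) K"
          using e_sign[OF c3] e_sign[OF c12] e1 by blast
        have "q' \<in> Z" using pre e' c3 by (auto simp: Z_def)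
        moreover have "slope q1 < slope q'"
          unfolding slope_def
          using crossing_slope[OF e1 e' rp' _ eq3 ct hp] p'(5) by simp
        ultimately show False using max by (meson leD)
      qed
    qed
  qed
qed

lemma no_inside: "\<not> inside q p1 p2"
  using inside_imp_crossing no_crossing by blast

end

section \<open>Separation\<close>

lemma nonneg_span_superset: "x \<in> X \<Longrightarrow> 0 \<le> a \<Longrightarrow> a *\<^sub>R x \<in> nonneg_span X"
  using nonneg_comb_sum[of "{x}" X "\<lambda>_. a"] by simp

lemma convex_nonneg_span: "convex (nonneg_span X)"
proof (rule convexI)
  fix x y :: "real ^ 3" and u v :: real
  assume x: "x \<in> nonneg_span X" and y: "y \<in> nonneg_span X" and uv: "0 \<le> u" "0 \<le> v" "u + v = 1"
  obtain F c where F: "finite F" "F \<subseteq> X" "\<forall>z\<in>F. 0 \<le> c z" "x = (\<Sum>z\<in>F. c z *\<^sub>R z)"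
    using x unfolding nonneg_span_def by blast
  obtain G d where G: "finite G" "G \<subseteq> X" "\<forall>z\<in>G. 0 \<le> d z" "y = (\<Sum>z\<in>G. d z *\<^sub>R z)"
    using y unfolding nonneg_span_def by blast
  define e where "e z = u * (if z \<in> F then c z else 0) + v * (if z \<in> G then d z else 0)" for z
  have "x = (\<Sum>z\<in>F \<union> G. (if z \<in> F then c z else 0) *\<^sub>R z)"
    unfolding F(4) by (rule sum.mono_neutral_cong_left) (use F G in auto)
  moreover have "y = (\<Sum>z\<in>F \<union> G. (if z \<in> G then d z else 0) *\<^sub>R z)"
    unfolding G(4) by (rule sum.mono_neutral_cong_left) (use F G in auto)
  ultimately have "u *\<^sub>R x + v *\<^sub>R y = (\<Sum>z\<in>F \<union> G. e z *\<^sub>R z)"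
    by (simp only: e_def scaleR_sum_right sum.distrib[symmetric] scaleR_scaleR scaleR_add_left)
  moreover have "\<dots> \<in> nonneg_span X"
    using F G uv by (intro nonneg_comb_sum) (auto simp: e_def)
  ultimately show "u *\<^sub>R x + v *\<^sub>R y \<in> nonneg_span X" by simp
qed

text \<open>A representation with the fewest terms has positive coefficients and linearly independent vectors:
  along a linear dependence the coefficients could be moved until one of them vanishes.\<close>

lemma nonneg_span_caratheodory:
  assumes "x \<in> nonneg_span X"
  shows "\<exists>F c. finite F \<and> card F \<le> 3 \<and> F \<subseteq> X \<and> (\<forall>y\<in>F. 0 < c y) \<and> x = (\<Sum>y\<in>F. c y *\<^sub>R y)"
proof -
  define rep where "rep F \<longleftrightarrow> finite F \<and> F \<subseteq> X \<and> (\<exists>c. (\<forall>y\<in>F. 0 \<le> c y) \<and> x = (\<Sum>y\<in>F. c y *\<^sub>R y))" for F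
  have "\<exists>F. rep F" using assms unfolding nonneg_span_def rep_def by blast
  then obtain F where "rep F" and min: "\<And>G. rep G \<Longrightarrow> card F \<le> card G"
    using ex_has_least_nat[of rep _ card] by blast
  then obtain c where F: "finite F" "F \<subseteq> X" "\<forall>y\<in>F. 0 \<le> c y" and x: "x = (\<Sum>y\<in>F. c y *\<^sub>R y)"
    unfolding rep_def by blast
  have nodrop: False if "y \<in> F" "d y = 0" "\<forall>z\<in>F. 0 \<le> d z" "x = (\<Sum>z\<in>F. d z *\<^sub>R z)" for d y
  proof -
    have "x = (\<Sum>z\<in>F - {y}. d z *\<^sub>R z)"
      using that F(1) by (simp add: sum.remove)
    then have "rep (F - {y})" using that F unfolding rep_def by blast
    then show False using min[of "F - {y}"] card_Diff1_less[OF F(1) that(1)] by simp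
  qed
  have pos: "0 < c y" if "y \<in> F" for y
    using nodrop[of y c] that F(3) x by (metis order_le_less)
  have "independent F"
  proof
    assume "dependent F"
    then obtain w where w: "\<exists>v\<in>F. w v \<noteq> 0" "(\<Sum>v\<in>F. w v *\<^sub>R v) = 0"
      using dependent_finite[OF F(1)] by blast
    obtain w where w: "\<exists>v\<in>F. 0 < w v" "(\<Sum>v\<in>F. w v *\<^sub>R v) = 0"
    proof (cases "\<exists>v\<in>F. 0 < w v")
      case True
      then show ?thesis using that[of w] w(2) by blast
    next
      case False
      then have "\<exists>v\<in>F. 0 < - w v" using w(1) by (metis linorder_neqE_linordered_idom neg_0_less_iff_less)
      moreover have "(\<Sum>v\<in>F. (- w v) *\<^sub>R v) = 0" using w(2) by (simp add: sum_negf)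
      ultimately show ?thesis using that[of "\<lambda>v. - w v"] by blast
    qed
    define G where "G = {v \<in> F. 0 < w v}"
    have G: "finite G" "G \<noteq> {}" using F(1) w(1) by (auto simp: G_def)
    \<comment> \<open>The largest multiple of the dependence that keeps all coefficients nonnegative.\<close>
    define t where "t = Min ((\<lambda>v. c v / w v) ` G)"
    have t_le: "t \<le> c v / w v" if "v \<in> G" for v
      unfolding t_def using G that by (intro Min_le) auto
    have "t \<in> (\<lambda>v. c v / w v) ` G"
      unfolding t_def using G by (intro Min_in) auto
    then obtain y where y: "y \<in> G" "t = c y / w y" by blast
    have t0: "0 \<le> t" using y F(3) by (auto simp: G_def)
    define d where "d v = c v - t * w v" for v
    have "d y = 0" using y by (simp add: d_def G_def)
    moreover have "0 \<le> d v" if "v \<in> F" for v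
    proof (cases "0 < w v")
      case True
      then show ?thesis using t_le[of v] that by (simp add: d_def G_def field_simps)
    next
      case False
      then have "t * w v \<le> 0" using t0 by (simp add: mult_nonneg_nonpos)
      moreover have "0 \<le> c v" using F(3) that by blast
      ultimately show ?thesis by (simp add: d_def)
    qed
    moreover have "(\<Sum>v\<in>F. d v *\<^sub>R v) = x - t *\<^sub>R (\<Sum>v\<in>F. w v *\<^sub>R v)"
      by (simp add: x d_def scaleR_sum_right sum_subtractf scaleR_diff_left)
    ultimately show False using nodrop[of y d] y w(2) by (simp add: G_def)
  qed
  then have "card F \<le> 3" using independent_bound[of F] by simp
  then show ?thesis using F x pos by blast
qed

context pencil
begin

text \<open>In a representation of \<open>\<alpha>\<^sub>k\<close> by at most three vectors, pairing with \<open>\<alpha>\<^sub>k\<close> and comparing heights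
  show that both \<open>P\<close> and \<open>Q\<close> occur. The remaining three shapes are a root of \<open>Q\<close> between one of \<open>P\<close> and
  \<open>\<alpha>\<^sub>k\<close>, an instance of \<open>inside\<close>, and an instance of \<open>crossing\<close>.\<close>

lemma simple_root_not_in_cone: "K \<notin> nonneg_span (root_of ` Collect Q \<union> (\<lambda>p. - root_of p) ` Collect P)"
proof
  assume "K \<in> nonneg_span (root_of ` Collect Q \<union> (\<lambda>p. - root_of p) ` Collect P)"
  from nonneg_span_caratheodory[OF this] obtain F c where F: "finite F" "card F \<le> 3"
    "F \<subseteq> root_of ` Collect Q \<union> (\<lambda>p. - root_of p) ` Collect P"
    and pos: "\<forall>y\<in>F. 0 < c y" and K: "K = (\<Sum>y\<in>F. c y *\<^sub>R y)"
    by blast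
  define A where "A = F \<inter> root_of ` Collect Q"
  define B where "B = F - A"
  have AB: "finite A" "finite B" "A \<inter> B = {}" "F = A \<union> B" using F(1) by (auto simp: A_def B_def)
  have A: "\<exists>q. Q q \<and> y = root_of q \<and> 0 < c y" if "y \<in> A" for y using that pos by (auto simp: A_def)
  have B: "\<exists>p. P p \<and> y = - root_of p \<and> 0 < c y" if "y \<in> B" for y using that pos F(3) by (auto simp: A_def B_def)
  have K_AB: "K = (\<Sum>y\<in>A. c y *\<^sub>R y) + (\<Sum>y\<in>B. c y *\<^sub>R y)"
    using K AB by (simp add: sum.union_disjoint)
  have height_sum: "height (\<Sum>y\<in>G. g y) = (\<Sum>y\<in>G. height (g y))" for g :: "real ^ 3 \<Rightarrow> real ^ 3" and G
    by (simp add: height_def sum.distrib)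
  have form_sum: "form K (\<Sum>y\<in>G. g y) = (\<Sum>y\<in>G. form K (g y))" for g :: "real ^ 3 \<Rightarrow> real ^ 3" and G
    by (induction G rule: infinite_finite_induct) (simp_all add: form_simps)
  have "A \<noteq> {}"
  proof
    assume "A = {}"
    then have "1 = (\<Sum>y\<in>B. c y * height y)"
      using arg_cong[OF K_AB, of height] by (simp add: height_simps height_sum)
    moreover have "c y * height y \<le> 0" if "y \<in> B" for y
    proof -
      obtain p where p: "P p" "y = - root_of p" "0 < c y" using B[OF \<open>y \<in> B\<close>] by blast
      have "height y = - height (root_of p)" by (simp add: p height_def)
      then show ?thesis using height_root_pos[OF P_reduced[OF p(1)]] p(3) by (simp add: mult_nonneg_nonpos)
    qed
    then have "(\<Sum>y\<in>B. c y * height y) \<le> 0" by (rule sum_nonpos)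
    ultimately show False by simp
  qed
  moreover have "B \<noteq> {}"
  proof
    assume "B = {}"
    then have "1 = (\<Sum>y\<in>A. c y * form K y)"
      using arg_cong[OF K_AB, of "form K"] by (simp add: form_simps form_sum form_simple_root)
    moreover have "c y * form K y \<le> 0" if "y \<in> A" for y
      using A[OF that] form_K_Q by (smt (verit, best) mult_nonneg_nonpos)
    then have "(\<Sum>y\<in>A. c y * form K y) \<le> 0" by (rule sum_nonpos)
    ultimately show False by simp
  qed
  moreover have "card A + card B \<le> 3" using F(2) AB by (simp add: card_Un_disjoint)
  moreover from calculation have "0 < card A" "0 < card B" using AB(1,2) by (simp_all add: card_gt_0_iff)
  ultimately have "card A = 1 \<and> card B = 1 \<or> card A = 1 \<and> card B = 2 \<or> card A = 2 \<and> card B = 1"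
    by linarith
  then show False
  proof (elim disjE conjE)
    assume cards: "card A = 1" "card B = 1"
    obtain x where x: "A = {x}" using cards(1) by (rule card_1_singletonE)
    obtain y where y: "B = {y}" using cards(2) by (rule card_1_singletonE)
    note xy = x y
    obtain q p where q: "Q q" "x = root_of q" "0 < c x" and p: "P p" "y = - root_of p" "0 < c y"
      using A[of x] B[of y] xy by auto
    have "c y *\<^sub>R root_of p + 1 *\<^sub>R K = c x *\<^sub>R root_of q" using K_AB p(2) q(2) by (simp add: xy algebra_simps)
    then show False using not_on_segment[OF p(1) q(1,3), of "c y" 1] p(3) by simp
  next
    assume cards: "card A = 1" "card B = 2"
    obtain x where x: "A = {x}" using cards(1) by (rule card_1_singletonE)
    obtain y z where yz: "B = {y, z}" "y \<noteq> z" using cards(2) unfolding card_2_iff by blast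
    note xyz = x yz
    obtain q p p' where q: "Q q" "x = root_of q" "0 < c x" and p: "P p" "y = - root_of p" "0 < c y"
      and p': "P p'" "z = - root_of p'" "0 < c z"
      using A[of x] B[of y] B[of z] xyz by auto
    have "K = c x *\<^sub>R x + (c y *\<^sub>R y + c z *\<^sub>R z)" using K_AB xyz by simp
    then have "c y *\<^sub>R root_of p + c z *\<^sub>R root_of p' + K = c x *\<^sub>R root_of q"
      by (simp add: p(2) p'(2) q(2) algebra_simps)
    then show False using insideI[OF q(1) p(1) p'(1) p(3) p'(3) q(3)] no_inside by blast
  next
    assume cards: "card A = 2" "card B = 1"
    obtain x where x: "B = {x}" using cards(2) by (rule card_1_singletonE)
    obtain y z where yz: "A = {y, z}" "y \<noteq> z" using cards(1) unfolding card_2_iff by blast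
    note xyz = x yz
    obtain p q q' where p: "P p" "x = - root_of p" "0 < c x" and q: "Q q" "y = root_of q" "0 < c y"
      and q': "Q q'" "z = root_of q'" "0 < c z"
      using B[of x] A[of y] A[of z] xyz by auto
    have "K = (c y *\<^sub>R y + c z *\<^sub>R z) + c x *\<^sub>R x" using K_AB xyz by simp
    then have "c x *\<^sub>R root_of p + K = c y *\<^sub>R root_of q + c z *\<^sub>R root_of q'"
      by (simp add: p(2) q(2) q'(2) algebra_simps)
    then show False using crossingI[OF p(1) q(1) q'(1) p(3) q(3) q'(3)] no_crossing by blast
  qed
qed

lemma separating_functional:
  "\<exists>n. n \<noteq> 0 \<and> (\<forall>q. Q q \<longrightarrow> n \<bullet> root_of q \<le> 0) \<and> (\<forall>p. P p \<longrightarrow> 0 \<le> n \<bullet> root_of p)"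
proof -
  define S where "S = root_of ` Collect Q \<union> (\<lambda>p. - root_of p) ` Collect P"
  have zero: "0 \<in> nonneg_span S" using nonneg_comb_sum[of "{}" S] by simp
  obtain n b where n: "n \<noteq> 0" "\<forall>x\<in>nonneg_span S. n \<bullet> x \<le> b" "b \<le> n \<bullet> K"
    using separating_hyperplane_sets[of "nonneg_span S" "{K}"] convex_nonneg_span zero
      simple_root_not_in_cone unfolding S_def[symmetric] by auto
  have le: "n \<bullet> y \<le> 0" if "y \<in> S" for y
  proof (rule ccontr)
    assume "\<not> n \<bullet> y \<le> 0"
    then have ny: "0 < n \<bullet> y" by simp
    \<comment> \<open>The cone contains all multiples of \<open>y\<close>, and this one exceeds the bound \<open>b\<close>.\<close>
    define t where "t = (\<bar>b\<bar> + 1) / (n \<bullet> y)"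
    have "t *\<^sub>R y \<in> nonneg_span S"
      using ny that by (intro nonneg_span_superset) (simp_all add: t_def)
    then have "t * (n \<bullet> y) \<le> b" using n(2) by fastforce
    then show False using ny by (simp add: t_def)
  qed
  have "n \<bullet> root_of q \<le> 0" if "Q q" for q using le[of "root_of q"] that by (auto simp: S_def)
  moreover have "0 \<le> n \<bullet> root_of p" if "P p" for p using le[of "- root_of p"] that by (auto simp: S_def)
  ultimately show ?thesis using n(1) by blast
qed

end

section \<open>The closure of a coclosed set is biclosed\<close>

lemma closed_words_halfspace: "closed_words (\<lambda>w. reduced_word w \<and> n \<bullet> root_of w \<le> 0)"
  unfolding closed_words_def
  by (auto simp: inner_add_right intro!: add_nonpos_nonpos mult_nonneg_nonpos)

text \<open>Both roots have form value \<open>1\<close> with themselves, and both are positive.\<close>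

lemma root_scale:
  assumes "reduced_word u" "reduced_word v" "root_of u = c *\<^sub>R root_of v"
  shows "u = v"
proof -
  have "c * c = 1"
    using form_root_self[of u] form_root_self[of v] assms by (simp add: form_simps)
  moreover have "0 < c"
    using nonneg_root_comb_imp_pos[of v v u c 0] assms by simp
  ultimately have "c = 1" by (metis mult_cancel_right1 mult_1 square_eq_1_iff less_asym neg_0_less_iff_less zero_less_one)
  then show ?thesis using root_inject assms by simp
qed

lemma independent_roots:
  assumes "reduced_word u" "reduced_word v" "u \<noteq> v"
  shows "independent {root_of u, root_of v}" "root_of u \<noteq> root_of v"
proof -
  show neq: "root_of u \<noteq> root_of v" using root_inject assms by blast
  have "root_of u \<notin> span {root_of v}"
    using root_scale[OF assms(1,2)] assms(3) by (auto simp: span_singleton)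
  then show "independent {root_of u, root_of v}"
    using root_nonzero assms(2) by (simp add: independent_insert neq)
qed

lemma plane_spanned_by_roots:
  assumes "reduced_word u" "reduced_word v" "u \<noteq> v"
    and "n \<noteq> 0" "n \<bullet> root_of u = 0" "n \<bullet> root_of v = 0" "n \<bullet> x = 0"
  shows "\<exists>s t. x = s *\<^sub>R root_of u + t *\<^sub>R root_of v"
proof -
  let ?U = "{root_of u, root_of v}"
  note ind = independent_roots[OF assms(1-3)]
  have "span ?U \<subseteq> {x. n \<bullet> x = 0}"
    using assms(5,6) by (intro span_minimal) (auto simp: subspace_hyperplane)
  moreover have "dim (span ?U) = 2"
    using ind by (simp add: dim_eq_card_independent)
  moreover have "dim {x. n \<bullet> x = 0} = 2"
    using dim_hyperplane[OF assms(4)] by simp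
  ultimately have "span ?U = {x. n \<bullet> x = 0}"
    by (intro subspace_dim_equal subspace_span subspace_hyperplane) auto
  then have "x \<in> span ?U" using assms(7) by blast
  then obtain s where "x - s *\<^sub>R root_of u \<in> span {root_of v}"
    by (auto simp: span_insert)
  then obtain t where "x - s *\<^sub>R root_of u = t *\<^sub>R root_of v"
    by (auto simp: span_singleton)
  then have "x = s *\<^sub>R root_of u + t *\<^sub>R root_of v" by (simp add: algebra_simps)
  then show ?thesis by blast
qed

lemma coordinates_unique:
  assumes "reduced_word u" "reduced_word v" "u \<noteq> v"
    and "s *\<^sub>R root_of u + t *\<^sub>R root_of v = s' *\<^sub>R root_of u + t' *\<^sub>R root_of v"
  shows "s = s'"
proof (rule ccontr)
  assume ne: "s \<noteq> s'"
  have "(s - s') *\<^sub>R root_of u = (t' - t) *\<^sub>R root_of v"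
    using assms(4) by (simp add: algebra_simps)
  then have "root_of u = ((t' - t) / (s - s')) *\<^sub>R root_of v"
    using ne by (metis (no_types, lifting) divide_inverse_commute eq_iff_diff_eq_0 scaleR_left_imp_eq scaleR_scaleR
        right_inverse scaleR_one mult.commute)
  then show False using root_scale assms(1-3) by blast
qed

locale minimal_coclosed_closure = coclosed_closure +
  assumes minimal: "closed_words S \<Longrightarrow> (\<And>w. X w \<Longrightarrow> S w) \<Longrightarrow> C w \<Longrightarrow> S w"
begin

lemma X_reduced: "X w \<Longrightarrow> reduced_word w"
  using X_imp_C C_reduced by blast

lemma subtree_single:
  assumes "closed_words S" "\<And>m n. m \<noteq> k \<Longrightarrow> S (fan_word [] k m n)"
  shows "subtree S [k]"
proof -
  have "rays S [k]"
    unfolding rays_def using assms(2)[of _ "Suc _"] by simp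
  moreover obtain m :: 3 where "m \<noteq> k" using ex_third_letter by blast
  then have "S [k]" using assms(2)[of m 0] by simp
  ultimately show ?thesis
    using rays_imp[OF assms(1), of "[k]"] unfolding subtree_def prefix_def by (metis append_Nil2 distinct_adj_singleton list.distinct(1))
qed

text \<open>For \<open>k\<close> with \<open>X [k]\<close> and \<open>m\<close> without \<open>X [m]\<close>, coclosedness in the fan of \<open>k\<close> and \<open>m\<close> says that the
  \<open>k\<close>-side is contained in \<open>X\<close> or the \<open>m\<close>-side misses \<open>X\<close>. Going through the possible sets of simple
  roots in \<open>X\<close>, one letter wins against both others.\<close>

lemma ex_pure_letter: "\<exists>k. X [k] \<and> subtree C [k] \<or> \<not> X [k] \<and> subtree nX [k]"
proof -
  define A where "A k m \<longleftrightarrow> (\<forall>n. C (fan_word [] k m n))" for k m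
  define Z where "Z k m \<longleftrightarrow> (\<forall>n. nX (fan_word [] k m n))" for k m
  have apex: "fan_apex [] k m" if "k \<noteq> m" for k m using that by (simp add: fan_apex_def)
  have AA: "A k m" if "X [k]" "X [m]" "k \<noteq> m" for k m
    unfolding A_def using closed_words_fan[OF closed apex[OF that(3)], of 0 _ 0] X_imp_C that by simp
  have ZZ: "Z k m" if "\<not> X [k]" "\<not> X [m]" "k \<noteq> m" for k m
    unfolding Z_def using closed_words_fan[OF coclosed apex[OF that(3)], of 0 _ 0] that by simp
  have AZ: "A k m \<or> Z m k" if "X [k]" "\<not> X [m]" "k \<noteq> m" for k m
  proof (rule ccontr)
    assume no: "\<not> ?thesis"
    obtain i where "\<not> C (fan_word [] k m i)" using no unfolding A_def by blast
    then have i: "nX (fan_word [] k m i)"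
      using X_imp_C reduced_fan_word[OF apex[OF that(3)]] by blast
    obtain j where j: "\<not> nX (fan_word [] m k j)" using no unfolding Z_def by blast
    show False
      using closed_words_fan[OF coclosed apex[OF that(3)[symmetric]], of 0 j i] i j that(2) by simp
  qed
  have neq: "(1::3) \<noteq> 2" "(1::3) \<noteq> 3" "(2::3) \<noteq> 3" by simp_all
  have "\<exists>k. X [k] \<and> (\<forall>m. m \<noteq> k \<longrightarrow> A k m) \<or> \<not> X [k] \<and> (\<forall>m. m \<noteq> k \<longrightarrow> Z k m)"
  proof (rule ccontr)
    assume "\<nexists>k. X [k] \<and> (\<forall>m. m \<noteq> k \<longrightarrow> A k m) \<or> \<not> X [k] \<and> (\<forall>m. m \<noteq> k \<longrightarrow> Z k m)"
    then have no: "\<not> (X [k] \<and> (\<forall>m. m \<noteq> k \<longrightarrow> A k m))" "\<not> (\<not> X [k] \<and> (\<forall>m. m \<noteq> k \<longrightarrow> Z k m))" for k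
      by blast+
    show False
      using no[of 1, unfolded forall_3] no[of 2, unfolded forall_3] no[of 3, unfolded forall_3]
        AA[of 1 2] AA[of 1 3] AA[of 2 3] AA[of 2 1] AA[of 3 1] AA[of 3 2]
        ZZ[of 1 2] ZZ[of 1 3] ZZ[of 2 3] ZZ[of 2 1] ZZ[of 3 1] ZZ[of 3 2]
        AZ[of 1 2] AZ[of 1 3] AZ[of 2 3] AZ[of 2 1] AZ[of 3 1] AZ[of 3 2] neq by argo
  qed
  then obtain k where "X [k] \<and> (\<forall>m. m \<noteq> k \<longrightarrow> A k m) \<or> \<not> X [k] \<and> (\<forall>m. m \<noteq> k \<longrightarrow> Z k m)" by blast
  then show ?thesis
    using subtree_single[OF closed, of k] subtree_single[OF coclosed, of k] unfolding A_def Z_def by blast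
qed

text \<open>At the root of the tree the letter \<open>k\<close> itself guards both other branches.\<close>

lemma no_alternation_at_identity:
  assumes S: "closed_words S" "\<And>w. reduced_word w \<Longrightarrow> S w \<or> T w" "branches_separated S T" "S [k]"
    and "reduced_word u" "reduced_word v" "reduced_word w" "u \<parallel> v" "v \<parallel> w"
    and "hd u \<noteq> k" "hd v \<noteq> k" "hd w \<noteq> k" "\<not> S u" "\<not> T v" "\<not> S w"
    and "0 < vol (root_of u) (root_of v) (simple_root k)" "0 < vol (root_of v) (root_of w) (simple_root k)"
  shows False
proof -
  obtain a b where ab: "a \<noteq> b" "k \<noteq> a" "k \<noteq> b" "orientation [] a b = 1"
  proof -
    obtain a where a: "a \<noteq> k" using ex_third_letter by blast
    obtain b where b: "b \<noteq> k" "b \<noteq> a" using ex_third_letter by blast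
    show ?thesis
      using that[of a b] that[of b a] a b orientation_pm[of a b "[]"] orientation_swap[of "[]" b a] by auto
  qed
  have piv: "pivot S [] k d" if "d \<noteq> k" for d
    unfolding pivot_def
    by (rule exI[of _ "[]"], rule exI[of _ d], rule exI[of _ k], rule exI[of _ 0], rule exI[of _ 0])
       (use that S(4) in \<open>auto simp: fan_apex_def\<close>)
  have pre: "prefix ([] @ [a]) x \<or> prefix ([] @ [b]) x" if "reduced_word x" "hd x \<noteq> k" for x
    using that three_letters[OF ab(1-3), of "hd x"] by (cases x) auto
  show False
    by (rule no_alternation[OF S(1-3), of a b k "[]" k u v w]) (use assms ab piv pre in auto)
qed

lemma pencil_outside:
  assumes "\<not> X [k]" "subtree nX [k]"
  shows "pencil (\<lambda>w. reduced_word w \<and> \<not> C w) X k"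
proof
  have hdX: "hd q \<noteq> k" if "X q" for q
    using assms(2) that X_reduced[OF that] unfolding subtree_def
    by (metis append_Cons append_Nil list.collapse prefixI)
  show "reduced_word p" if "reduced_word p \<and> \<not> C p" for p using that by blast
  show "reduced_word q" if "X q" for q using X_reduced[OF that] .
  show "hd q \<noteq> k" if "X q" for q using hdX[OF that] .
  show "\<exists>q' s t. X q' \<and> q' \<parallel> p \<and> 0 < s \<and> 0 < t \<and>
        root_of q = s *\<^sub>R root_of p + t *\<^sub>R root_of q' \<and> length q' < length q"
    if hyp: "reduced_word p \<and> \<not> C p" "X q" "strict_prefix p q" for p q
  proof -
    obtain e s t where e: "reduced_word e" "e \<parallel> p" "0 < s" "0 < t"
      "root_of q = s *\<^sub>R root_of p + t *\<^sub>R root_of e" "length e < length q"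
      using strict_prefix_root_decomposition[of p q] hyp X_reduced[OF hyp(2)] by blast
    have "X e"
      using closed_wordsD[OF coclosed, of p e q s t] hyp X_imp_C[of p] X_reduced[OF hyp(2)] e
      by (auto simp: less_imp_le)
    then show ?thesis using e by blast
  qed
  show "\<exists>p' s t. (reduced_word p' \<and> \<not> C p') \<and> p' \<parallel> q \<and> 0 < s \<and> 0 < t \<and>
        root_of p = s *\<^sub>R root_of q + t *\<^sub>R root_of p' \<and> length p' < length p"
    if hyp: "reduced_word p \<and> \<not> C p" "X q" "strict_prefix q p" for p q
  proof -
    obtain e s t where e: "reduced_word e" "e \<parallel> q" "0 < s" "0 < t"
      "root_of p = s *\<^sub>R root_of q + t *\<^sub>R root_of e" "length e < length p"
      using strict_prefix_root_decomposition[of q p] hyp X_reduced[OF hyp(2)] by blast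
    have "\<not> C e"
      using closed_wordsD[OF closed, of q e p s t] hyp X_imp_C[of q] e by (auto simp: less_imp_le)
    then show ?thesis using e by blast
  qed
  show False if "reduced_word p \<and> \<not> C p" "X q" "0 \<le> a" "0 \<le> b"
    "root_of q = a *\<^sub>R root_of p + b *\<^sub>R simple_root k" for p q a b
    using closed_wordsD[OF coclosed, of p "[k]" q a b] that X_imp_C[of p] X_reduced[of q] assms(1) by auto
  show False if "X u" "reduced_word v \<and> \<not> C v" "X w" "hd v \<noteq> k" "u \<parallel> v" "v \<parallel> w"
    "0 < vol (root_of u) (root_of v) (simple_root k)" "0 < vol (root_of v) (root_of w) (simple_root k)" for u v w
    by (rule no_alternation_at_identity[OF coclosed _ branches_separated_commute[OF branches_separated_closure], of k u v w])
       (use that assms X_imp_C X_reduced hdX in auto)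
qed

lemma pencil_inside:
  assumes "X [k]" "subtree C [k]"
  shows "pencil X (\<lambda>w. reduced_word w \<and> \<not> C w) k"
proof
  have hdC: "hd q \<noteq> k" if "reduced_word q \<and> \<not> C q" for q
    using assms(2) that unfolding subtree_def
    by (metis append_Cons append_Nil list.collapse prefixI)
  show "reduced_word p" if "X p" for p using X_reduced[OF that] .
  show "reduced_word q" if "reduced_word q \<and> \<not> C q" for q using that by blast
  show "hd q \<noteq> k" if "reduced_word q \<and> \<not> C q" for q using hdC[OF that] .
  show "\<exists>q' s t. (reduced_word q' \<and> \<not> C q') \<and> q' \<parallel> p \<and> 0 < s \<and> 0 < t \<and>
        root_of q = s *\<^sub>R root_of p + t *\<^sub>R root_of q' \<and> length q' < length q"
    if hyp: "X p" "reduced_word q \<and> \<not> C q" "strict_prefix p q" for p q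
  proof -
    obtain e s t where e: "reduced_word e" "e \<parallel> p" "0 < s" "0 < t"
      "root_of q = s *\<^sub>R root_of p + t *\<^sub>R root_of e" "length e < length q"
      using strict_prefix_root_decomposition[of p q] hyp X_reduced[OF hyp(1)] by blast
    have "\<not> C e"
      using closed_wordsD[OF closed, of p e q s t] hyp X_imp_C[of p] e by (auto simp: less_imp_le)
    then show ?thesis using e by blast
  qed
  show "\<exists>p' s t. X p' \<and> p' \<parallel> q \<and> 0 < s \<and> 0 < t \<and>
        root_of p = s *\<^sub>R root_of q + t *\<^sub>R root_of p' \<and> length p' < length p"
    if hyp: "X p" "reduced_word q \<and> \<not> C q" "strict_prefix q p" for p q
  proof -
    obtain e s t where e: "reduced_word e" "e \<parallel> q" "0 < s" "0 < t"
      "root_of p = s *\<^sub>R root_of q + t *\<^sub>R root_of e" "length e < length p"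
      using strict_prefix_root_decomposition[of q p] hyp X_reduced[OF hyp(1)] by blast
    have "X e"
      using closed_wordsD[OF coclosed, of q e p s t] hyp X_imp_C[of q] X_reduced[OF hyp(1)] e
      by (auto simp: less_imp_le)
    then show ?thesis using e by blast
  qed
  show False if "X p" "reduced_word q \<and> \<not> C q" "0 \<le> a" "0 \<le> b"
    "root_of q = a *\<^sub>R root_of p + b *\<^sub>R simple_root k" for p q a b
    using closed_wordsD[OF closed, of p "[k]" q a b] that X_imp_C assms(1) by auto
  show False if "reduced_word u \<and> \<not> C u" "X v" "reduced_word w \<and> \<not> C w" "hd v \<noteq> k" "u \<parallel> v" "v \<parallel> w"
    "0 < vol (root_of u) (root_of v) (simple_root k)" "0 < vol (root_of v) (root_of w) (simple_root k)" for u v w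
    by (rule no_alternation_at_identity[OF closed _ branches_separated_closure, of k u v w])
       (use that assms X_imp_C X_reduced hdC in auto)
qed

lemma separates_complement:
  "\<exists>n. n \<noteq> 0 \<and> (\<forall>w. X w \<longrightarrow> n \<bullet> root_of w \<le> 0) \<and> (\<forall>w. reduced_word w \<and> \<not> C w \<longrightarrow> 0 \<le> n \<bullet> root_of w)"
proof -
  obtain k where "X [k] \<and> subtree C [k] \<or> \<not> X [k] \<and> subtree nX [k]"
    using ex_pure_letter by blast
  then show ?thesis
  proof
    assume *: "X [k] \<and> subtree C [k]"
    interpret pencil X "\<lambda>w. reduced_word w \<and> \<not> C w" k
      by (rule pencil_inside) (use * in auto)
    obtain n where "n \<noteq> 0" "\<forall>q. reduced_word q \<and> \<not> C q \<longrightarrow> n \<bullet> root_of q \<le> 0"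
      "\<forall>p. X p \<longrightarrow> 0 \<le> n \<bullet> root_of p"
      using separating_functional by blast
    then show ?thesis by (intro exI[of _ "- n"]) simp
  next
    assume *: "\<not> X [k] \<and> subtree nX [k]"
    interpret pencil "\<lambda>w. reduced_word w \<and> \<not> C w" X k
      by (rule pencil_outside) (use * in auto)
    show ?thesis by (rule separating_functional)
  qed
qed

text \<open>The roots with \<open>n < 0\<close>, together with those in the plane \<open>n = 0\<close> that lie strictly beyond \<open>v\<close> as
  seen from \<open>u\<close>, form a closed set. It contains \<open>X\<close>, hence \<open>C\<close>, but not \<open>w\<close>, since coordinates with respect to \<open>u\<close>, \<open>v\<close> are unique.\<close>

lemma no_root_between_if_one_sided:
  assumes n: "n \<noteq> 0" "\<And>w. X w \<Longrightarrow> n \<bullet> root_of w \<le> 0"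
    and uv: "reduced_word u" "reduced_word v" "u \<noteq> v" "n \<bullet> root_of u = 0" "n \<bullet> root_of v = 0"
    and side: "\<And>x s t. X x \<Longrightarrow> root_of x = s *\<^sub>R root_of u + t *\<^sub>R root_of v \<Longrightarrow> s < 0"
    and w: "C w" "root_of w = a *\<^sub>R root_of u + b *\<^sub>R root_of v" "0 < a"
  shows False
proof -
  define S where "S x \<longleftrightarrow> reduced_word x \<and>
    (n \<bullet> root_of x < 0 \<or> (\<exists>s t. root_of x = s *\<^sub>R root_of u + t *\<^sub>R root_of v \<and> s < 0))" for x
  have S_le: "n \<bullet> root_of x \<le> 0" if "S x" for x
    using that uv(4,5) by (auto simp: S_def inner_add_right)
  have "closed_words S"
    unfolding closed_words_def
  proof (intro conjI allI impI)
    fix x y z and c d :: real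
    assume x: "S x" and y: "S y" and z: "reduced_word z" and cd: "0 \<le> c" "0 \<le> d"
      and eq: "root_of z = c *\<^sub>R root_of x + d *\<^sub>R root_of y"
    have nz: "n \<bullet> root_of z = c * (n \<bullet> root_of x) + d * (n \<bullet> root_of y)"
      by (simp add: eq inner_add_right)
    have le: "c * (n \<bullet> root_of x) \<le> 0" "d * (n \<bullet> root_of y) \<le> 0"
      using cd S_le[OF x] S_le[OF y] by (simp_all add: mult_nonneg_nonpos)
    show "S z"
    proof (cases "n \<bullet> root_of z < 0")
      case True
      then show ?thesis using z by (simp add: S_def)
    next
      case False
      then have 0: "c * (n \<bullet> root_of x) = 0" "d * (n \<bullet> root_of y) = 0" using nz le by linarith+
      have ex: "\<exists>s t. e *\<^sub>R root_of r = s *\<^sub>R root_of u + t *\<^sub>R root_of v \<and> s \<le> 0 \<and> (e \<noteq> 0 \<longrightarrow> s < 0)"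
        if r: "S r" "0 \<le> e" "e * (n \<bullet> root_of r) = 0" for e r
      proof (cases "e = 0")
        case True
        then show ?thesis by (intro exI[of _ 0]) simp
      next
        case False
        then obtain s t where "root_of r = s *\<^sub>R root_of u + t *\<^sub>R root_of v" "s < 0"
          using r by (auto simp: S_def)
        then have "e *\<^sub>R root_of r = (e * s) *\<^sub>R root_of u + (e * t) *\<^sub>R root_of v" "e * s < 0"
          using False r(2) by (simp_all add: scaleR_add_right mult_pos_neg)
        then show ?thesis by (intro exI[of _ "e * s"] exI[of _ "e * t"]) simp
      qed
      obtain s t where s: "c *\<^sub>R root_of x = s *\<^sub>R root_of u + t *\<^sub>R root_of v" "s \<le> 0" "c \<noteq> 0 \<longrightarrow> s < 0"
        using ex[OF x cd(1) 0(1)] by blast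
      obtain s' t' where s': "d *\<^sub>R root_of y = s' *\<^sub>R root_of u + t' *\<^sub>R root_of v" "s' \<le> 0" "d \<noteq> 0 \<longrightarrow> s' < 0"
        using ex[OF y cd(2) 0(2)] by blast
      have "c \<noteq> 0 \<or> d \<noteq> 0" using eq root_nonzero z by auto
      then have "s + s' < 0" using s(2,3) s'(2,3) by linarith
      moreover have "root_of z = (s + s') *\<^sub>R root_of u + (t + t') *\<^sub>R root_of v"
        unfolding eq s(1) s'(1) by (simp add: algebra_simps)
      ultimately show ?thesis using z unfolding S_def by blast
    qed
  qed (simp_all add: S_def)
  moreover have "S x" if "X x" for x
  proof (cases "n \<bullet> root_of x = 0")
    case True
    then show ?thesis
      using plane_spanned_by_roots[OF uv(1-3) n(1) uv(4,5)] side[OF that] X_reduced[OF that]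
      unfolding S_def by blast
  next
    case False
    then show ?thesis using n(2)[OF that] X_reduced[OF that] by (simp add: S_def)
  qed
  ultimately have "S w" using minimal w(1) by blast
  moreover have "n \<bullet> root_of w = 0" using uv(4,5) by (simp add: w(2) inner_add_right)
  ultimately obtain s t where "root_of w = s *\<^sub>R root_of u + t *\<^sub>R root_of v" "s < 0"
    by (auto simp: S_def)
  then show False using coordinates_unique[OF uv(1-3), of a b s t] w(2,3) by simp
qed

text \<open>A root of \<open>C\<close> between \<open>u\<close> and \<open>v\<close> is in the plane \<open>n = 0\<close> of the separating functional, and so are \<open>u\<close>
  and \<open>v\<close>. In that plane a root of \<open>X\<close> is never between \<open>u\<close> and \<open>v\<close>, by coclosedness; if roots of \<open>X\<close>
  occurred beyond both ends, then \<open>v\<close> would be between two of them and belong to \<open>C\<close>. So they are all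
  beyond the same end.\<close>

theorem complement_closed: "closed_words (\<lambda>w. reduced_word w \<and> \<not> C w)"
  unfolding closed_words_def
proof (intro conjI allI impI)
  fix u v w and a b :: real
  assume u: "reduced_word u \<and> \<not> C u" and v: "reduced_word v \<and> \<not> C v" and w: "reduced_word w"
    and ab: "0 \<le> a" "0 \<le> b" and eq: "root_of w = a *\<^sub>R root_of u + b *\<^sub>R root_of v"
  show "\<not> C w"
  proof
    assume Cw: "C w"
    obtain n where n: "n \<noteq> 0" and nX: "\<And>w. X w \<Longrightarrow> n \<bullet> root_of w \<le> 0"
      and nC: "\<And>w. reduced_word w \<Longrightarrow> \<not> C w \<Longrightarrow> 0 \<le> n \<bullet> root_of w"
      using separates_complement by blast
    have "n \<bullet> root_of w \<le> 0"
      using minimal[OF closed_words_halfspace[of n] _ Cw] nX X_reduced by blast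
    moreover have "0 \<le> a * (n \<bullet> root_of u)" "0 \<le> b * (n \<bullet> root_of v)" using nC u v ab by simp_all
    moreover have "n \<bullet> root_of w = a * (n \<bullet> root_of u) + b * (n \<bullet> root_of v)"
      by (simp add: eq inner_add_right)
    ultimately have 0: "a * (n \<bullet> root_of u) = 0" "b * (n \<bullet> root_of v) = 0"
      by linarith+
    have "a \<noteq> 0" using root_scale[of w v b] eq w v Cw by auto
    moreover have "b \<noteq> 0" using root_scale[of w u a] eq w u Cw by auto
    ultimately have pos: "0 < a" "0 < b" and n0: "n \<bullet> root_of u = 0" "n \<bullet> root_of v = 0" using 0 ab by auto
    have uv: "reduced_word u" "reduced_word v" "u \<noteq> v"
      using u v root_scale[of w v "a + b"] eq w Cw by (auto simp: scaleR_add_left)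
    have outside: "s < 0 \<and> 0 < t \<or> 0 < s \<and> t < 0"
      if x: "X x" "root_of x = s *\<^sub>R root_of u + t *\<^sub>R root_of v" for x s t
    proof -
      have "\<not> (0 \<le> s \<and> 0 \<le> t)"
        using closed_wordsD[OF coclosed, of u v x s t] X_reduced[OF x(1)] X_imp_C u v x by blast
      moreover have "0 < s \<or> 0 < t"
        using nonneg_root_comb_imp_pos[OF uv(1,2) X_reduced[OF x(1)] x(2)] .
      ultimately show ?thesis by linarith
    qed
    have one_side: False if x: "X x" "root_of x = s *\<^sub>R root_of u + t *\<^sub>R root_of v" "s < 0"
      and y: "X y" "root_of y = s' *\<^sub>R root_of u + t' *\<^sub>R root_of v" "0 < s'" for x y s t s' t'
    proof -
      \<comment> \<open>Combine \<open>x\<close> and \<open>y\<close> such that \<open>u\<close> cancels; heights show that the remaining multiple of \<open>v\<close> is positive.\<close>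
      define D where "D = s' * t - s * t'"
      have Deq: "D *\<^sub>R root_of v = s' *\<^sub>R root_of x + (- s) *\<^sub>R root_of y"
        unfolding x(2) y(2) D_def by (simp add: algebra_simps)
      have "D * height (root_of v) = s' * height (root_of x) + (- s) * height (root_of y)"
        using arg_cong[OF Deq, of height] by (simp add: height_simps)
      moreover have "0 < s' * height (root_of x)" "0 < (- s) * height (root_of y)"
        using height_root_pos[OF X_reduced[OF x(1)]] height_root_pos[OF X_reduced[OF y(1)]] x(3) y(3)
        by (simp_all add: mult_neg_pos)
      ultimately have "0 < D * height (root_of v)" by linarith
      then have D: "0 < D" using height_root_pos[of v] uv(2) by (simp add: zero_less_mult_iff)
      have "root_of v = (1 / D) *\<^sub>R (D *\<^sub>R root_of v)" using D by simp
      also have "\<dots> = (s' / D) *\<^sub>R root_of x + (- s / D) *\<^sub>R root_of y"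
        unfolding Deq by (simp add: scaleR_diff_right)
      finally have veq: "root_of v = (s' / D) *\<^sub>R root_of x + (- s / D) *\<^sub>R root_of y" .
      have "C v"
        by (rule closed_wordsD[OF closed X_imp_C[OF x(1)] X_imp_C[OF y(1)] uv(2) _ _ veq])
          (use D x(3) y(3) in \<open>auto simp: divide_nonpos_pos\<close>)
      then show False using v by blast
    qed
    show False
    proof (cases "\<exists>x s t. X x \<and> root_of x = s *\<^sub>R root_of u + t *\<^sub>R root_of v \<and> 0 < s")
      case True
      then have side: "s < 0" if "X x" "root_of x = s *\<^sub>R root_of v + t *\<^sub>R root_of u" for x s t
        using one_side outside[OF that(1), of t s] that by (metis add.commute)
      have eq': "root_of w = b *\<^sub>R root_of v + a *\<^sub>R root_of u" by (simp add: eq)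
      show False
        by (rule no_root_between_if_one_sided[OF n nX uv(2,1) uv(3)[symmetric] n0(2,1) side Cw eq' pos(2)])
    next
      case False
      then have side: "s < 0" if "X x" "root_of x = s *\<^sub>R root_of u + t *\<^sub>R root_of v" for x s t
        using outside[OF that] that by blast
      show False
        by (rule no_root_between_if_one_sided[OF n nX uv n0 side Cw eq pos(1)])
    qed
  qed
qed auto

end

section \<open>Joins in the extended weak order\<close>

lemma root_closed_iff_closed_words:
  assumes "A \<subseteq> positive_roots"
  shows "root_closed A \<longleftrightarrow> closed_words (\<lambda>w. reduced_word w \<and> root_of w \<in> A)"
proof
  assume A: "root_closed A"
  show "closed_words (\<lambda>w. reduced_word w \<and> root_of w \<in> A)"
    unfolding closed_words_def
  proof (intro conjI allI impI)
    fix u v w and a b :: real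
    assume u: "reduced_word u \<and> root_of u \<in> A" and v: "reduced_word v \<and> root_of v \<in> A"
      and w: "reduced_word w" "0 \<le> a" "0 \<le> b" "root_of w = a *\<^sub>R root_of u + b *\<^sub>R root_of v"
    have "root_of w \<in> nonneg_span {root_of u, root_of v}"
      using w nonneg_span_pair by blast
    moreover have "root_of w \<in> positive_roots"
      using w(1) by (simp add: positive_roots_eq)
    ultimately show "root_of w \<in> A"
      using A u v unfolding root_closed_def by blast
  qed auto
next
  assume A: "closed_words (\<lambda>w. reduced_word w \<and> root_of w \<in> A)"
  show "root_closed A"
    unfolding root_closed_def
  proof (intro conjI ballI subsetI)
    fix x y z assume x: "x \<in> A" and y: "y \<in> A" and z: "z \<in> nonneg_span {x, y} \<inter> positive_roots"
    have word: "\<exists>u. reduced_word u \<and> t = root_of u" if "t \<in> positive_roots" for t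
      using that by (auto simp: positive_roots_eq)
    obtain u where u: "reduced_word u" "x = root_of u" using word[of x] x assms by blast
    obtain v where v: "reduced_word v" "y = root_of v" using word[of y] y assms by blast
    obtain w where w: "reduced_word w" "z = root_of w" using word[of z] z by blast
    obtain a b where "0 \<le> a" "0 \<le> b" "z = a *\<^sub>R x + b *\<^sub>R y" using z nonneg_span_pair by blast
    then show "z \<in> A"
      using closed_wordsD[OF A, of u v w a b] u v w x y by simp
  qed (use assms in blast)
qed

text \<open>A union of biclosed sets is coclosed but in general not closed. Taking the closure repairs this
  without losing coclosedness.\<close>

theorem root_closed_hull_coclosed:
  assumes X: "X \<subseteq> positive_roots" and coclosed: "root_closed (positive_roots - X)"
  shows "root_biclosed (root_closed hull X)"
proof -
  define H where "H = root_closed hull X"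
  note H = root_closed_hull_smallest[OF X, folded H_def]
  have H_pos: "H \<subseteq> positive_roots" using H(1) by (simp add: root_closed_def)
  interpret minimal_coclosed_closure "\<lambda>w. reduced_word w \<and> root_of w \<in> X" "\<lambda>w. reduced_word w \<and> root_of w \<in> H"
  proof
    have "(\<lambda>w. reduced_word w \<and> root_of w \<in> positive_roots - X)
        = (\<lambda>w. reduced_word w \<and> \<not> (reduced_word w \<and> root_of w \<in> X))"
      by (auto simp: positive_roots_eq)
    then show "closed_words (\<lambda>w. reduced_word w \<and> \<not> (reduced_word w \<and> root_of w \<in> X))"
      using coclosed root_closed_iff_closed_words[of "positive_roots - X"] by auto
    show "closed_words (\<lambda>w. reduced_word w \<and> root_of w \<in> H)"
      using H(1) root_closed_iff_closed_words[OF H_pos] by blast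
    show "reduced_word w \<and> root_of w \<in> H" if "reduced_word w \<and> root_of w \<in> X" for w
      using that H(2) by blast
    fix S w
    assume S: "closed_words S" "\<And>w. reduced_word w \<and> root_of w \<in> X \<Longrightarrow> S w" and w: "reduced_word w \<and> root_of w \<in> H"
    have S_red: "reduced_word x" if "S x" for x using S(1) that by (simp add: closed_words_def)
    have "(\<lambda>x. reduced_word x \<and> root_of x \<in> root_of ` Collect S) = S"
      using S_red root_inject by blast
    then have "closed_words (\<lambda>x. reduced_word x \<and> root_of x \<in> root_of ` Collect S)"
      using S(1) by simp
    moreover have "root_of ` Collect S \<subseteq> positive_roots" using S_red by (auto simp: positive_roots_eq)
    ultimately have "root_closed (root_of ` Collect S)"
      by (simp only: root_closed_iff_closed_words)
    moreover have "X \<subseteq> root_of ` Collect S" using X S(2) by (auto simp: positive_roots_eq)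
    ultimately have "root_of w \<in> root_of ` Collect S" using H(3) w by blast
    then show "S w" using S_red root_inject w by blast
  qed
  have "(\<lambda>w. reduced_word w \<and> \<not> (reduced_word w \<and> root_of w \<in> H))
      = (\<lambda>w. reduced_word w \<and> root_of w \<in> positive_roots - H)"
    by (auto simp: positive_roots_eq)
  then have "root_closed (positive_roots - H)"
    using complement_closed root_closed_iff_closed_words[of "positive_roots - H"] by auto
  then show ?thesis using H(1) by (simp add: root_biclosed_def H_def)
qed

theorem theorem2:
  fixes I :: "'i set" and R :: "'i \<Rightarrow> (real ^ 3) set"
  assumes "\<And>i. i \<in> I \<Longrightarrow> root_biclosed (R i)"
  shows "is_lub extended_weak_order (root_closed hull (\<Union>i\<in>I. R i)) (R ` I)"
proof -
  define X where "X = (\<Union>i\<in>I. R i)"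
  have X: "X \<subseteq> positive_roots"
    using assms unfolding X_def root_biclosed_def root_closed_def by blast
  have "root_closed (positive_roots - X)"
    unfolding root_closed_def
  proof (intro conjI ballI)
    fix x y assume xy: "x \<in> positive_roots - X" "y \<in> positive_roots - X"
    have "nonneg_span {x, y} \<inter> positive_roots \<subseteq> positive_roots - R i" if "i \<in> I" for i
    proof -
      have "root_closed (positive_roots - R i)"
        using assms[OF that] by (simp add: root_biclosed_def)
      moreover have "x \<in> positive_roots - R i" "y \<in> positive_roots - R i"
        using xy that by (auto simp: X_def)
      ultimately show ?thesis unfolding root_closed_def by blast
    qed
    then show "nonneg_span {x, y} \<inter> positive_roots \<subseteq> positive_roots - X"
      unfolding X_def by blast
  qed blast
  then have biclosed: "root_biclosed (root_closed hull X)"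
    by (rule root_closed_hull_coclosed[OF X])
  have upper: "R i \<subseteq> root_closed hull X" if "i \<in> I" for i
    using root_closed_hull_smallest(2)[OF X] that by (auto simp: X_def)
  have least: "root_closed hull X \<subseteq> Y" if "root_biclosed Y" "\<forall>i\<in>I. R i \<subseteq> Y" for Y
    using root_closed_hull_smallest(3)[OF X] that by (auto simp: X_def root_biclosed_def)
  show ?thesis
    unfolding X_def[symmetric] least_def Upper_def extended_weak_order_def
    using biclosed upper least assms by auto
qed

end
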